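(* Let $g(t)=\sum_{i=1}^na_it^i\in\mathbb C[t]$, $n\geq2$, $a_n\neq0$, and set $u(h):=2h+\tfrac12$. Then $$T_3(g)\simeq M\Big(\tfrac14,(1,0,n-1),R(h)^{-1}L(h+1)^{-1}\Big),$$ where $L(h),R(h)\in\mathrm{GL}_n(\mathbb C[h])$ are defined as follows (all entries not specified are $0$). If $a_1\neq0$: - $R_{11}=1$, $R_{12}=-\tfrac1{a_1}u(h+\tfrac12)$, $R_{22}=1$, $R_{ii}=-1$ for $3\leq i\leq n$; - $L_{1,n}=-\tfrac{2}{na_1a_n}$; $L_{2,n-1}=\tfrac{a_1}{2na_n}$, $L_{2,n}=-\tfrac{(n-1)a_1a_{n-1}+na_nu(h)}{2n^2a_n^2}$; and for $3\leq i\leq n$: $L_{i,i-2}=\tfrac12$, $L_{i,n-1}=-\tfrac{(i-1)a_{i-1}}{2na_n}$, $L_{i,n}=\tfrac{-(i-2)na_{i-2}a_n+(i-1)(n-1)a_{i-1}a_{n-1}}{2n^2a_n^2}$. If $a_1=0$: - $R_{11}=1$, $R_{12}=\tfrac12u(h+\tfrac12)$, $R_{21}=1$, $R_{22}=\tfrac12u(h)$, $R_{ii}=1$ for $3\leq i\leq n$; - $L_{1,n-1}=\tfrac2{na_n}$, $L_{1,n}=-\tfrac{2((n-1)a_{n-1}+na_n)}{n^2a_n^2}$; $L_{2,n-1}=-\tfrac1{na_n}u(h+\tfrac12)$, $L_{2,n}=\tfrac{(n-1)a_{n-1}u(h+\frac12)+na_nu(h)}{n^2a_n^2}$; and for $3\leq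 i\leq n$: $L_{i,i-2}=-\tfrac12$, $L_{i,n-1}=\tfrac{(i-1)a_{i-1}}{2na_n}$, $L_{i,n}=\tfrac{(i-2)na_{i-2}a_n-(i-1)(n-1)a_{i-1}a_{n-1}}{2n^2a_n^2}$.
   Context: The Lie algebra $\mathfrak{sl}(2)$ over $\mathbb C$ has basis $e,f,h$ with $[h,e]=e$, $[h,f]=-f$, $[e,f]=2h$; $\mathfrak h=\mathbb Ch$. The automorphism $\sigma$ of $\mathbb C[h]$ is $\sigma(g(h))=g(h-1)$, applied entrywise. For $E,F\in\mathrm{Mat}_n(\mathbb C[h])$ with $E\sigma(F)-F\sigma^{-1}(E)=2h\,\mathrm I_n$, $M(E,F)$ is the $\mathfrak{sl}(2)$-module on $\mathbb C[h]^{\oplus n}$ with $h$ acting by multiplication, $e\cdot\boldsymbol g=E\sigma(\boldsymbol g)$, $f\cdot\boldsymbol g=F\sigma^{-1}(\boldsymbol g)$. Put $\lambda_\alpha(h)=-(h-\alpha+1)(h+\alpha)$. For $\boldsymbol a=(a_-,a_0,a_+)\in\mathbb Z_{\geq0}^3$ with $a_-+a_0+a_+=n$, $P_{(\boldsymbol a,\alpha)}(h)$ is the diagonal $n\times n$ matrix with diagonal entries: $1$ ($a_-$ times), then $h-\alpha+1$ ($a_0$ times), then $(h-\alpha+1)(h+\alpha)$ ($a_+$ times); $\overline P_{(\boldsymbol a,\alpha)}(h)$ is the diagonal matrix with $\overline P_{(\boldsymbol a,\alpha)}P_{(\boldsymbol a,\alpha)}=\lambda_\alpha(h)\mathrm I_n$.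 For $K(h)\in\mathrm{GL}_n(\mathbb C[h])$ set $M(\alpha,\boldsymbol a,K(h)):=M\big(\sigma(K^{-1}(h)\overline P_{(\boldsymbol a,\alpha)}(h)),P_{(\boldsymbol a,\alpha)}(h)K(h)\big)$. $T_3(g)$ denotes $\mathbb C[t]e^g$ (with $\partial=d/dt$ acting by $\partial(pe^g)=(p'+pg')e^g$) as an $\mathfrak{sl}(2)$-module via $e\mapsto\tfrac12t^2$, $f\mapsto-\tfrac12\partial^2$, $h\mapsto\tfrac12t\partial+\tfrac14$. *)

theory Defs
  imports "Jordan_Normal_Form.VS_Connect"
begin

section \<open>The Lie algebra sl(2) and its modules\<close>

text \<open>The Lie algebra of traceless complex 2 x 2 matrices under the commutator.  The basis is
  normalised so that [h,e] = e, [h,f] = -f, [e,f] = 2h; hence h is half of the usual diag(1,-1).\<close>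

definition sl2 :: "complex mat set" where
  "sl2 = {x \<in> carrier_mat 2 2. x $$ (0,0) + x $$ (1,1) = 0}"

definition lie_bracket :: "complex mat \<Rightarrow> complex mat \<Rightarrow> complex mat" where
  "lie_bracket x y = x * y - y * x"

definition sl2_e :: "complex mat" where
  "sl2_e = mat 2 2 (\<lambda>(i,j). if (i,j) = (0,1) then 1 else 0)"

definition sl2_f :: "complex mat" where
  "sl2_f = mat 2 2 (\<lambda>(i,j). if (i,j) = (1,0) then 1 else 0)"

definition sl2_h :: "complex mat" where
  "sl2_h = mat 2 2 (\<lambda>(i,j). if i = j then if i = 0 then 1/2 else - 1/2 else 0)"

lemma lie_bracket_basis:
  "lie_bracket sl2_h sl2_e = sl2_e"
  "lie_bracket sl2_h sl2_f = - sl2_f"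
  "lie_bracket sl2_e sl2_f = 2 \<cdot>\<^sub>m sl2_h"
  by (rule eq_matI; auto simp: lie_bracket_def sl2_e_def sl2_f_def sl2_h_def
        scalar_prod_def less_2_cases_iff numeral_2_eq_2)+

lemma sl2_basis: "sl2_e \<in> sl2" "sl2_f \<in> sl2" "sl2_h \<in> sl2"
  by (auto simp: sl2_def sl2_e_def sl2_f_def sl2_h_def)

lemma sl2_decomp:
  assumes "x \<in> sl2"
  shows "x = x $$ (0,1) \<cdot>\<^sub>m sl2_e + x $$ (1,0) \<cdot>\<^sub>m sl2_f + (2 * x $$ (0,0)) \<cdot>\<^sub>m sl2_h"
proof (rule eq_matI)
  have tr: "x $$ (Suc 0, Suc 0) = - x $$ (0,0)"
    using assms by (auto simp: sl2_def add_eq_0_iff)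
  show "x $$ (i,j) = (x $$ (0,1) \<cdot>\<^sub>m sl2_e + x $$ (1,0) \<cdot>\<^sub>m sl2_f + (2 * x $$ (0,0)) \<cdot>\<^sub>m sl2_h) $$ (i,j)"
    if "i < dim_row (x $$ (0,1) \<cdot>\<^sub>m sl2_e + x $$ (1,0) \<cdot>\<^sub>m sl2_f + (2 * x $$ (0,0)) \<cdot>\<^sub>m sl2_h)"
      "j < dim_col (x $$ (0,1) \<cdot>\<^sub>m sl2_e + x $$ (1,0) \<cdot>\<^sub>m sl2_f + (2 * x $$ (0,0)) \<cdot>\<^sub>m sl2_h)" for i j
    using that tr
    by (auto simp: sl2_e_def sl2_f_def sl2_h_def less_2_cases_iff)
qed (use assms in \<open>auto simp: sl2_def sl2_e_def sl2_f_def sl2_h_def\<close>)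

record 'v sl2_mod = "(complex, 'v) module" +
  act :: "complex mat \<Rightarrow> 'v \<Rightarrow> 'v"

locale sl2_module = Module.module "class_ring :: complex ring" V
  for V :: "('v, 'm) sl2_mod_scheme" (structure) +
  assumes act_closed: "\<lbrakk>x \<in> sl2; v \<in> carrier V\<rbrakk> \<Longrightarrow> act V x v \<in> carrier V"
    and act_add_left: "\<lbrakk>x \<in> sl2; y \<in> sl2; v \<in> carrier V\<rbrakk> \<Longrightarrow>
      act V (x + y) v = act V x v \<oplus>\<^bsub>V\<^esub> act V y v"
    and act_smult_left: "\<lbrakk>x \<in> sl2; v \<in> carrier V\<rbrakk> \<Longrightarrow>
      act V (c \<cdot>\<^sub>m x) v = c \<odot>\<^bsub>V\<^esub> act V x v"
    and act_add_right: "\<lbrakk>x \<in> sl2; v \<in> carrier V; w \<in> carrier V\<rbrakk> \<Longrightarrow>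
      act V x (v \<oplus>\<^bsub>V\<^esub> w) = act V x v \<oplus>\<^bsub>V\<^esub> act V x w"
    and act_smult_right: "\<lbrakk>x \<in> sl2; v \<in> carrier V\<rbrakk> \<Longrightarrow>
      act V x (c \<odot>\<^bsub>V\<^esub> v) = c \<odot>\<^bsub>V\<^esub> act V x v"
    and act_bracket: "\<lbrakk>x \<in> sl2; y \<in> sl2; v \<in> carrier V\<rbrakk> \<Longrightarrow>
      act V (lie_bracket x y) v = act V x (act V y v) \<ominus>\<^bsub>V\<^esub> act V y (act V x v)"

definition sl2_isomorphic :: "('v, 'm) sl2_mod_scheme \<Rightarrow> ('w, 'k) sl2_mod_scheme \<Rightarrow> bool"
    (infix \<open>\<simeq>\<close> 50) where
  "V \<simeq> W \<longleftrightarrow> sl2_module V \<and> sl2_module W \<and>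
    (\<exists>\<phi> \<in> LinearCombinations.module_hom (class_ring :: complex ring) V W. bij_betw \<phi> (carrier V) (carrier W) \<and>
      (\<forall>x\<in>sl2. \<forall>v\<in>carrier V. \<phi> (act V x v) = act W x (\<phi> v)))"

text \<open>The action on a complex vector space in which e, f, h act by the operators eo, fo, ho,
  extended linearly; the coefficients are those of the expansion of x in the basis e, f, h (see sl2_decomp).\<close>

definition act_of :: "(complex, 'v) module \<Rightarrow> ('v \<Rightarrow> 'v) \<Rightarrow> ('v \<Rightarrow> 'v) \<Rightarrow> ('v \<Rightarrow> 'v) \<Rightarrow>
    'v sl2_mod" where
  "act_of V eo fo ho = module.extend V (sl2_mod.fields (\<lambda>x v.
     x $$ (0,1) \<odot>\<^bsub>V\<^esub> eo v \<oplus>\<^bsub>V\<^esub> x $$ (1,0) \<odot>\<^bsub>V\<^esub> fo v \<oplus>\<^bsub>V\<^esub> (2 * x $$ (0,0)) \<odot>\<^bsub>V\<^esub> ho v))"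


section \<open>The modules M(E,F)\<close>

text \<open>shift c g is g(h + c).\<close>

definition shift :: "complex \<Rightarrow> complex poly \<Rightarrow> complex poly" where
  "shift c g = g \<circ>\<^sub>p [:c, 1:]"

definition sigma :: "complex poly \<Rightarrow> complex poly" where
  "sigma = shift (- 1)"

definition sigma_inv :: "complex poly \<Rightarrow> complex poly" where
  "sigma_inv = shift 1"

lemma sigma_inverses: "sigma (sigma_inv g) = g" "sigma_inv (sigma g) = g"
  by (simp_all add: sigma_def sigma_inv_def shift_def pcompose_pCons flip: pcompose_assoc)

definition poly_vec_space :: "nat \<Rightarrow> (complex, complex poly vec) module" where
  "poly_vec_space n = \<lparr>carrier = carrier_vec n, mult = undefined, one = undefined,
     zero = 0\<^sub>v n, add = (+), smult = (\<lambda>c g. [:c:] \<cdot>\<^sub>v g)\<rparr>"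

text \<open>This is an sl(2)-module when E sigma(F) - F sigma_inv(E) = 2h I, with sigma and sigma_inv applied entrywise.\<close>

definition M_mod :: "nat \<Rightarrow> complex poly mat \<Rightarrow> complex poly mat \<Rightarrow> complex poly vec sl2_mod" where
  "M_mod n E F = act_of (poly_vec_space n)
     (\<lambda>g. E *\<^sub>v map_vec sigma g) (\<lambda>g. F *\<^sub>v map_vec sigma_inv g) (\<lambda>g. [:0, 1:] \<cdot>\<^sub>v g)"

definition lam :: "complex \<Rightarrow> complex poly" where
  "lam \<alpha> = - ([:1 - \<alpha>, 1:] * [:\<alpha>, 1:])"

fun P_entry :: "nat \<times> nat \<times> nat \<Rightarrow> complex \<Rightarrow> nat \<Rightarrow> complex poly" where
  "P_entry (am, a0, ap) \<alpha> i =
     (if i < am then 1 else if i < am + a0 then [:1 - \<alpha>, 1:] else [:1 - \<alpha>, 1:] * [:\<alpha>, 1:])"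

fun size3 :: "nat \<times> nat \<times> nat \<Rightarrow> nat" where
  "size3 (am, a0, ap) = am + a0 + ap"

definition P_mat :: "nat \<times> nat \<times> nat \<Rightarrow> complex \<Rightarrow> complex poly mat" where
  "P_mat a \<alpha> = mat_diag (size3 a) (P_entry a \<alpha>)"

definition Pbar_mat :: "nat \<times> nat \<times> nat \<Rightarrow> complex \<Rightarrow> complex poly mat" where
  "Pbar_mat a \<alpha> = (THE D. D \<in> carrier_mat (size3 a) (size3 a) \<and> diagonal_mat D \<and>
     D * P_mat a \<alpha> = lam \<alpha> \<cdot>\<^sub>m 1\<^sub>m (size3 a))"

text \<open>The diagonal matrix with Pbar P = lam I exists and is unique.\<close>

lemma Pbar_mat_ex1:
  "\<exists>!D. D \<in> carrier_mat (size3 a) (size3 a) \<and> diagonal_mat D \<and>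
     D * P_mat a \<alpha> = lam \<alpha> \<cdot>\<^sub>m 1\<^sub>m (size3 a)"
proof -
  let ?n = "size3 a"
  have nz: "P_entry a \<alpha> i \<noteq> 0" for i
    by (cases a) auto
  have dvd: "P_entry a \<alpha> i dvd lam \<alpha>" for i
    by (cases a) (auto simp: lam_def simp del: mult_pCons_left mult_pCons_right)
  show ?thesis
  proof (rule ex1I)
    let ?D = "mat_diag ?n (\<lambda>i. lam \<alpha> div P_entry a \<alpha> i)"
    show "?D \<in> carrier_mat ?n ?n \<and> diagonal_mat ?D \<and> ?D * P_mat a \<alpha> = lam \<alpha> \<cdot>\<^sub>m 1\<^sub>m ?n"
      using dvd by (auto simp: P_mat_def diagonal_mat_def mat_diag_mult_left intro!: eq_matI)
         (auto simp: mat_diag_def)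
  next
    fix D assume D: "D \<in> carrier_mat ?n ?n \<and> diagonal_mat D \<and>
      D * P_mat a \<alpha> = lam \<alpha> \<cdot>\<^sub>m 1\<^sub>m ?n"
    show "D = mat_diag ?n (\<lambda>i. lam \<alpha> div P_entry a \<alpha> i)"
    proof (rule eq_matI)
      fix i j assume "i < dim_row (mat_diag ?n (\<lambda>i. lam \<alpha> div P_entry a \<alpha> i))"
        "j < dim_col (mat_diag ?n (\<lambda>i. lam \<alpha> div P_entry a \<alpha> i))"
      then have ij: "i < ?n" "j < ?n" by (auto simp: mat_diag_def)
      have "D * P_mat a \<alpha> = mat ?n ?n (\<lambda>(i,j). D $$ (i,j) * P_entry a \<alpha> j)"
        using D unfolding P_mat_def by (intro mat_diag_mult_right) blast
      then have "D $$ (i,i) * P_entry a \<alpha> i = lam \<alpha>"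
        using D ij by (metis (no_types, lifting) index_mat(1) index_one_mat(1) index_one_mat(2)
            index_one_mat(3) index_smult_mat(1) mult.right_neutral case_prod_conv)
      then have "D $$ (i,i) = lam \<alpha> div P_entry a \<alpha> i"
        using nz by (metis nonzero_mult_div_cancel_right)
      moreover have "D $$ (i,j) = 0" if "i \<noteq> j"
        using D ij that by (auto simp: diagonal_mat_def)
      ultimately show "D $$ (i,j) = mat_diag ?n (\<lambda>i. lam \<alpha> div P_entry a \<alpha> i) $$ (i,j)"
        using ij by (auto simp: mat_diag_def)
    qed (use D in \<open>auto simp: mat_diag_def\<close>)
  qed
qed

abbreviation poly_mat_ring :: "nat \<Rightarrow> complex poly mat ring" where
  "poly_mat_ring n \<equiv> ring_mat TYPE(complex poly) n ()"

definition GL_poly :: "nat \<Rightarrow> complex poly mat set" where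
  "GL_poly n = Units (poly_mat_ring n)"

definition GL_inv :: "nat \<Rightarrow> complex poly mat \<Rightarrow> complex poly mat" where
  "GL_inv n K = inv\<^bsub>poly_mat_ring n\<^esub> K"

definition M_param :: "complex \<Rightarrow> nat \<times> nat \<times> nat \<Rightarrow> complex poly mat \<Rightarrow>
    complex poly vec sl2_mod" where
  "M_param \<alpha> a K = (let n = size3 a in
     M_mod n (map_mat sigma (GL_inv n K * Pbar_mat a \<alpha>)) (P_mat a \<alpha> * K))"


section \<open>The modules of exponential type\<close>

text \<open>The element p e^g of C[t]e^g is represented by p.\<close>

definition exp_space :: "(complex, complex poly) module" where
  "exp_space = \<lparr>carrier = UNIV, mult = undefined, one = undefined,
     zero = 0, add = (+), smult = Polynomial.smult\<rparr>"

definition exp_deriv :: "complex poly \<Rightarrow> complex poly \<Rightarrow> complex poly" where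
  "exp_deriv g p = pderiv p + p * pderiv g"

definition T3 :: "complex poly \<Rightarrow> complex poly sl2_mod" where
  "T3 g = act_of exp_space
     (\<lambda>p. Polynomial.smult (1/2) ([:0, 1:]^2 * p))
     (\<lambda>p. Polynomial.smult (- 1/2) (exp_deriv g (exp_deriv g p)))
     (\<lambda>p. Polynomial.smult (1/2) ([:0, 1:] * exp_deriv g p) + Polynomial.smult (1/4) p)"


section \<open>The matrices L and R\<close>

definition u_poly :: "complex poly" where
  "u_poly = [:1/2, 2:]"

text \<open>Entries are given with row and column indices starting at 1.\<close>

definition mat1 :: "nat \<Rightarrow> (nat \<Rightarrow> nat \<Rightarrow> complex poly) \<Rightarrow> complex poly mat" where
  "mat1 n m = mat n n (\<lambda>(i,j). m (Suc i) (Suc j))"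

definition R_mat :: "nat \<Rightarrow> (nat \<Rightarrow> complex) \<Rightarrow> complex poly mat" where
  "R_mat n a = mat1 n (\<lambda>i j.
     if a 1 \<noteq> 0 then
       (if (i,j) = (1,1) then 1
        else if (i,j) = (1,2) then Polynomial.smult (- 1 / a 1) (shift (1/2) u_poly)
        else if (i,j) = (2,2) then 1
        else if 3 \<le> i \<and> j = i then - 1
        else 0)
     else
       (if (i,j) = (1,1) then 1
        else if (i,j) = (1,2) then Polynomial.smult (1/2) (shift (1/2) u_poly)
        else if (i,j) = (2,1) then 1
        else if (i,j) = (2,2) then Polynomial.smult (1/2) u_poly
        else if 3 \<le> i \<and> j = i then 1
        else 0))"

definition L_mat :: "nat \<Rightarrow> (nat \<Rightarrow> complex) \<Rightarrow> complex poly mat" where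
  "L_mat n a = (let N = of_nat n :: complex; N1 = of_nat (n - 1) :: complex in mat1 n (\<lambda>i j.
     if a 1 \<noteq> 0 then
       (if (i,j) = (1,n) then [:- 2 / (N * a 1 * a n):]
        else if (i,j) = (2,n-1) then [:a 1 / (2 * N * a n):]
        else if (i,j) = (2,n) then
          Polynomial.smult (- 1 / (2 * N^2 * (a n)^2))
            ([:N1 * a 1 * a (n-1):] + Polynomial.smult (N * a n) u_poly)
        else if 3 \<le> i \<and> j = i - 2 then [:1/2:]
        else if 3 \<le> i \<and> j = n - 1 then [:- (of_nat (i-1) * a (i-1)) / (2 * N * a n):]
        else if 3 \<le> i \<and> j = n then
          [:(- (of_nat (i-2) * N * a (i-2) * a n) + of_nat (i-1) * N1 * a (i-1) * a (n-1))
              / (2 * N^2 * (a n)^2):]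
        else 0)
     else
       (if (i,j) = (1,n-1) then [:2 / (N * a n):]
        else if (i,j) = (1,n) then [:- 2 * (N1 * a (n-1) + N * a n) / (N^2 * (a n)^2):]
        else if (i,j) = (2,n-1) then Polynomial.smult (- 1 / (N * a n)) (shift (1/2) u_poly)
        else if (i,j) = (2,n) then
          Polynomial.smult (1 / (N^2 * (a n)^2))
            (Polynomial.smult (N1 * a (n-1)) (shift (1/2) u_poly) + Polynomial.smult (N * a n) u_poly)
        else if 3 \<le> i \<and> j = i - 2 then [:- 1/2:]
        else if 3 \<le> i \<and> j = n - 1 then [:of_nat (i-1) * a (i-1) / (2 * N * a n):]
        else if 3 \<le> i \<and> j = n then
          [:(of_nat (i-2) * N * a (i-2) * a n - of_nat (i-1) * N1 * a (i-1) * a (n-1))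
              / (2 * N^2 * (a n)^2):]
        else 0)))"

end

theory Submission
  imports Defs
begin

text \<open>
  Multiplication by h on T3 g raises degrees by exactly n, so division by h shows that
  C[t] e^g is free over C[h] with basis 1, t, ..., t^(n-1).  Up to the factor 1/2 or -1/2, the
  columns of L are the coordinates of this basis in another basis v.  The vectors e v_j are easily
  written in the monomials, and their coordinates form the matrix (sigma R)(sigma Pbar); hence
  E = L (sigma R)(sigma Pbar) is the matrix of e in the basis v.  The matrix of f needs no
  computation: both e f and E sigma(F) are multiplication by sigma(lambda), and e is injective.
\<close>

section \<open>The operators e, f, h on exponential modules\<close>

text \<open>The shape of R and the case distinction come from the quotient of T3 g by the image t^2
  C[t] of e. It is spanned by 1 and t, and with D = \<open>exp_deriv g\<close> one has t D 1 = a_1 t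
  and t D t = t modulo t^2. Hence h has the eigenvalues 1/4 and 3/4 there, the two roots of
  sigma(lambda) for alpha = 1/4, and the quotient is cyclic over C[h]: this is why lambda occurs
  just once in Pbar. If a_1 is nonzero, 1 generates it; if a_1 = 0, both 1 and t are eigenvectors
  and 1 + t is taken as generator. The first column of sigma(R) holds this generator, the second a
  combination of 1 and t that lies in the image of e. Checking E sigma(F) - F sigma_inv(E) = 2h I by
  matrices is avoided: the module axioms are pulled back to M(E,F) along the injective coordinate
  map.\<close>

lemma poly_extI: "(\<And>x. poly p x = poly q x) \<Longrightarrow> p = q" for p q :: "complex poly"
  by (metis poly_eq_poly_eq_iff ext)

lemma exp_deriv_linear [simp]:
  "exp_deriv g (p + q) = exp_deriv g p + exp_deriv g q"
  "exp_deriv g (p - q) = exp_deriv g p - exp_deriv g q"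
  "exp_deriv g (- p) = - exp_deriv g p"
  "exp_deriv g (Polynomial.smult c p) = Polynomial.smult c (exp_deriv g p)"
  "exp_deriv g 0 = 0"
  by (simp_all add: exp_deriv_def pderiv_add pderiv_diff pderiv_minus pderiv_smult smult_add_right algebra_simps)

lemma exp_deriv_mult_2 [simp]: "exp_deriv g (p * 2) = exp_deriv g p * 2"
  by (simp only: mult_2_right exp_deriv_linear)

text \<open>The Heisenberg relation D t = t D + 1, from which the sl(2) relations follow.\<close>

lemma exp_deriv_X_mult [simp]: "exp_deriv g (pCons 0 p) = p + pCons 0 (exp_deriv g p)"
  by (rule poly_extI) (simp add: exp_deriv_def pderiv_mult pderiv_pCons algebra_simps)

definition e_op :: "complex poly \<Rightarrow> complex poly" where
  "e_op p = Polynomial.smult (1/2) ([:0, 1:]^2 * p)"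

definition f_op :: "complex poly \<Rightarrow> complex poly \<Rightarrow> complex poly" where
  "f_op g p = Polynomial.smult (- 1/2) (exp_deriv g (exp_deriv g p))"

definition h_op :: "complex poly \<Rightarrow> complex poly \<Rightarrow> complex poly" where
  "h_op g p = Polynomial.smult (1/2) ([:0, 1:] * exp_deriv g p) + Polynomial.smult (1/4) p"

lemma e_op_linear [simp]:
  "e_op (p + q) = e_op p + e_op q" "e_op (Polynomial.smult c p) = Polynomial.smult c (e_op p)" "e_op 0 = 0"
  by (rule poly_extI, simp add: e_op_def algebra_simps)+

lemma f_op_linear [simp]:
  "f_op g (p + q) = f_op g p + f_op g q" "f_op g (Polynomial.smult c p) = Polynomial.smult c (f_op g p)"
  by (rule poly_extI, simp add: f_op_def algebra_simps)+

lemma h_op_linear [simp]: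
  "h_op g (p + q) = h_op g p + h_op g q" "h_op g (Polynomial.smult c p) = Polynomial.smult c (h_op g p)" "h_op g 0 = 0"
  by (rule poly_extI, simp add: h_op_def algebra_simps)+

lemma e_op_inj:
  assumes "e_op p = e_op q"
  shows "p = q"
proof -
  have "Polynomial.smult 2 (Polynomial.smult (1/2) p) = Polynomial.smult 2 (Polynomial.smult (1/2) q)"
    using assms by (intro arg_cong[of _ _ "Polynomial.smult 2"]) (simp add: e_op_def power2_eq_square)
  then show ?thesis
    by (simp only: smult_smult) simp
qed

text \<open>Oriented as rewrite rules that bring every composite into the order f, h, e from the
  outside in.\<close>

lemma op_commutation:
  "e_op (h_op g p) = h_op g (e_op p) - e_op p"
  "h_op g (f_op g p) = f_op g (h_op g p) - f_op g p"
  "e_op (f_op g p) = f_op g (e_op p) + Polynomial.smult 2 (h_op g p)"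
  by (rule poly_extI; simp add: e_op_def f_op_def h_op_def power2_eq_square; simp add: algebra_simps field_simps)+

section \<open>The action of C[h]\<close>

text \<open>The polynomial q(h) in the operator h, applied to p (Horner scheme).\<close>

definition h_act :: "complex poly \<Rightarrow> complex poly \<Rightarrow> complex poly \<Rightarrow> complex poly" where
  "h_act g q p = fold_coeffs (\<lambda>c r. Polynomial.smult c p + h_op g r) q 0"

lemma h_act_0_left [simp]: "h_act g 0 p = 0"
  by (simp add: h_act_def)

lemma h_act_pCons [simp]: "h_act g (pCons c q) p = Polynomial.smult c p + h_op g (h_act g q p)"
  by (cases "c = 0 \<and> q = 0") (auto simp: h_act_def)

lemma h_act_1 [simp]: "h_act g 1 p = p"
  by (simp add: one_pCons)

lemma h_act_add_right [simp]: "h_act g q (p + r) = h_act g q p + h_act g q r"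
  by (induction q) (simp_all add: smult_add_right)

lemma h_act_smult_right [simp]: "h_act g q (Polynomial.smult c p) = Polynomial.smult c (h_act g q p)"
  by (induction q) (simp_all add: smult_add_right mult.commute)

lemma h_act_0_right [simp]: "h_act g q 0 = 0"
  by (induction q) simp_all

lemma h_act_add_left [simp]: "h_act g (q + r) p = h_act g q p + h_act g r p"
  by (induction q r rule: poly_induct2) (simp_all add: smult_add_left)

lemma h_act_smult_left [simp]: "h_act g (Polynomial.smult c q) p = Polynomial.smult c (h_act g q p)"
  by (induction q) (simp_all add: smult_add_right)

lemma h_act_minus_left [simp]: "h_act g (- q) p = - h_act g q p"
  using h_act_smult_left[of g "-1" q p] by simp

lemma h_act_diff_left [simp]: "h_act g (q - r) p = h_act g q p - h_act g r p"
  using h_act_add_left[of g q "- r" p] by simp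

lemma h_act_mult: "h_act g (q * r) p = h_act g q (h_act g r p)"
  by (induction q) simp_all

lemma h_act_sum_left: "h_act g (\<Sum>i\<in>A. q i) p = (\<Sum>i\<in>A. h_act g (q i) p)"
  by (induction A rule: infinite_finite_induct) simp_all

lemma h_act_sum_right: "h_act g q (\<Sum>i\<in>A. p i) = (\<Sum>i\<in>A. h_act g q (p i))"
  by (induction A rule: infinite_finite_induct) simp_all

lemma h_op_sum: "h_op g (\<Sum>i\<in>A. p i) = (\<Sum>i\<in>A. h_op g (p i))"
  by (induction A rule: infinite_finite_induct) simp_all

lemma e_op_sum: "e_op (\<Sum>i\<in>A. p i) = (\<Sum>i\<in>A. e_op (p i))"
  by (induction A rule: infinite_finite_induct) simp_all

section \<open>Shifts of the variable h and their operator meaning\<close>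

lemma shift_pCons [simp]: "shift c (pCons b q) = [:b:] + [:c, 1:] * shift c q"
  by (simp add: shift_def pcompose_pCons)

lemma shift_simps [simp]:
  "shift c (p + q) = shift c p + shift c q" "shift c (p * q) = shift c p * shift c q"
  "shift c 0 = 0" "shift c 1 = 1" "shift c (- p) = - shift c p"
  by (simp_all add: shift_def pcompose_add pcompose_mult pcompose_1 pcompose_uminus)

lemma sigma_simps:
  "sigma 0 = 0" "sigma 1 = 1" "sigma (- p) = - sigma p" "sigma (Polynomial.smult c p) = Polynomial.smult c (sigma p)"
  by (simp_all add: sigma_def shift_def pcompose_smult pcompose_uminus pcompose_1)

lemma semiring_hom_shift: "semiring_hom (shift c)"
  by unfold_locales simp_all

lemmas map_mat_shift_one = semiring_hom.mat_hom_one[OF semiring_hom_shift]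
  and map_mat_shift_mult = semiring_hom.mat_hom_mult[OF semiring_hom_shift]
  and map_vec_shift_mult = semiring_hom.mult_mat_vec_hom[OF semiring_hom_shift]

text \<open>The relation e h = (h - 1) e, carried through the Horner scheme.\<close>

lemma e_op_h_act: "e_op (h_act g q p) = h_act g (sigma q) (e_op p)"
proof (induction q)
  case (pCons c q)
  then show ?case
    using op_commutation(1)[of g "h_act g q p"] by (simp add: sigma_def)
qed (simp add: sigma_def)

text \<open>u(h) = 2h + 1/2 acts as t D + 1 = D t; the half shift adds 1 and sigma subtracts 2. This
  turns the entries of L and R into differential operators.\<close>

lemma h_act_u:
  "h_act g u_poly p = exp_deriv g (pCons 0 p)"
  "h_act g (shift (1/2) u_poly) p = exp_deriv g (pCons 0 p) + p"
  "h_act g (sigma u_poly) p = pCons 0 (exp_deriv g p) - p"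
  "h_act g (sigma (shift (1/2) u_poly)) p = pCons 0 (exp_deriv g p)"
  by (rule poly_extI; simp add: u_poly_def sigma_def h_op_def;
     simp add: field_simps)+

text \<open>e f = -(1/4) t^2 D^2 = -(1/4) t D (t D - 1), and t D = 2h - 1/2, so the product is -(h -
  1/4)(h - 3/4). The parameter 1/4 comes from here.\<close>

lemma h_act_sigma_lam:
  "h_act g (sigma (lam (1/4))) p = e_op (f_op g p)"
  by (rule poly_extI, simp add: lam_def sigma_def h_op_def e_op_def f_op_def power2_eq_square,
     simp add: field_simps)

section \<open>C[h]-linear combinations and freeness\<close>

text \<open>Coordinates are functions of the index, so that a matrix column can be inserted
  directly; \<open>vec_index\<close> gives the version for vectors.\<close>

definition lc :: "complex poly \<Rightarrow> nat \<Rightarrow> (nat \<Rightarrow> complex poly) \<Rightarrow> (nat \<Rightarrow> complex poly) \<Rightarrow>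
    complex poly" where
  "lc g n v w = (\<Sum>i<n. h_act g (w i) (v i))"

lemma smult_sum_right: "Polynomial.smult c (\<Sum>i\<in>A. p i) = (\<Sum>i\<in>A. Polynomial.smult c (p i))"
  by (induction A rule: infinite_finite_induct) (simp_all add: smult_add_right)

lemma lc_add: "lc g n v (\<lambda>i. w i + w' i) = lc g n v w + lc g n v w'"
  by (simp add: lc_def sum.distrib)

lemma lc_diff: "lc g n v (\<lambda>i. w i - w' i) = lc g n v w - lc g n v w'"
  by (simp add: lc_def sum_subtractf)

lemma lc_mult: "lc g n v (\<lambda>i. q * w i) = h_act g q (lc g n v w)"
  by (simp add: lc_def h_act_mult h_act_sum_right)

text \<open>For \<open>v = monom 1\<close> this is division by h: a remainder of degree below n plus
  h applied to a quotient.\<close>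

lemma lc_pCons:
  "lc g n v (\<lambda>i. pCons (c i) (w i)) = (\<Sum>i<n. Polynomial.smult (c i) (v i)) + h_op g (lc g n v w)"
  by (simp add: lc_def sum.distrib h_op_sum)

lemma lc_cong: "(\<And>i. i < n \<Longrightarrow> v i = v' i) \<Longrightarrow> (\<And>i. i < n \<Longrightarrow> w i = w' i) \<Longrightarrow> lc g n v w = lc g n v' w'"
  by (simp add: lc_def)

lemma lc_smult_left: "lc g n (\<lambda>i. Polynomial.smult c (v i)) w = Polynomial.smult c (lc g n v w)"
  by (simp add: lc_def smult_sum_right)

text \<open>Base change. Commutativity of C[h] allows \<open>w j\<close> to be moved outside
  \<open>A i j\<close> before the sums are exchanged.\<close>

lemma lc_linear_map:
  "lc g n v (\<lambda>i. \<Sum>j<n. A i j * w j) = lc g n (\<lambda>j. lc g n v (\<lambda>i. A i j)) w"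
proof -
  have "lc g n v (\<lambda>i. \<Sum>j<n. A i j * w j) = (\<Sum>i<n. \<Sum>j<n. h_act g (w j) (h_act g (A i j) (v i)))"
    by (simp add: lc_def h_act_sum_left mult.commute[of "A _ _"] h_act_mult)
  also have "\<dots> = (\<Sum>j<n. \<Sum>i<n. h_act g (w j) (h_act g (A i j) (v i)))"
    by (rule sum.swap)
  finally show ?thesis
    by (simp add: lc_def h_act_sum_right)
qed

text \<open>The top term stems from t p g' / 2 alone; t p' / 2 and p / 4 have degree at most that of
  p.\<close>

lemma degree_h_op:
  assumes "p \<noteq> 0" "degree g \<ge> 2"
  shows "degree (h_op g p) = degree p + degree g"
    and "coeff (h_op g p) (degree p + degree g) = of_nat (degree g) * lead_coeff g * lead_coeff p / 2"
proof -
  let ?d = "degree p" and ?n = "degree g"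
  have dg: "degree (pderiv g) = ?n - 1"
    by (rule degree_pderiv)
  have "coeff (h_op g p) (?d + ?n) = (coeff (pderiv p) (?d + ?n - 1)
      + coeff (p * pderiv g) (?d + ?n - 1)) / 2 + coeff p (?d + ?n) / 4"
    using assms by (simp add: h_op_def exp_deriv_def coeff_pCons split: nat.split)
  also have "coeff p (?d + ?n) = 0"
    using assms by (auto intro!: coeff_eq_0)
  also have "coeff (pderiv p) (?d + ?n - 1) = 0"
    using assms by (auto intro!: coeff_eq_0 simp: degree_pderiv)
  also have "coeff (p * pderiv g) (?d + ?n - 1) = lead_coeff p * lead_coeff (pderiv g)"
    using coeff_mult_degree_sum[of p "pderiv g"] assms dg by simp
  also have "lead_coeff (pderiv g) = of_nat ?n * lead_coeff g"
    using assms unfolding dg by (simp add: coeff_pderiv)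
  finally show *: "coeff (h_op g p) (?d + ?n) = of_nat ?n * lead_coeff g * lead_coeff p / 2"
    by simp
  have "lead_coeff g \<noteq> 0" "lead_coeff p \<noteq> 0"
    using assms by auto
  then have "coeff (h_op g p) (?d + ?n) \<noteq> 0"
    using assms unfolding * by auto
  moreover have "degree (h_op g p) \<le> ?d + ?n"
  proof -
    have "degree (exp_deriv g p) \<le> ?d + ?n - 1"
      unfolding exp_deriv_def using dg assms
      by (intro degree_add_le order.trans[OF degree_mult_le]) (auto simp: degree_pderiv)
    then have "degree (pCons 0 (exp_deriv g p)) \<le> ?d + ?n"
      using assms by (cases "exp_deriv g p = 0") (auto simp: degree_pCons_eq_if)
    then show ?thesis
      unfolding h_op_def by (intro degree_add_le order.trans[OF degree_smult_le]) auto
  qed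
  ultimately show "degree (h_op g p) = ?d + ?n"
    by (simp add: le_degree order_antisym)
qed

lemma degree_lessI:
  assumes "degree p \<le> d" "coeff p d = 0" "d > 0"
  shows "degree p < d"
  using assms by (cases "degree p = d") auto

lemma coeff_sum_monom: "coeff (\<Sum>i<n. monom (c i) i) k = (if k < n then c k else 0)"
  by (simp add: coeff_sum)

text \<open>Induction on a common degree bound of the coordinates. Their constant terms give a
  polynomial of degree below n, which cannot cancel h r: for nonzero r this has degree at least
  n.\<close>

lemma lc_monom_inj:
  assumes g: "degree g = n" "n \<ge> 2" and "lc g n (monom 1) w = 0" "i < n"
  shows "w i = 0"
proof -
  have "\<forall>i<n. w i = 0" if "\<forall>i<n. \<forall>k\<ge>d. coeff (w i) k = 0" "lc g n (monom 1) w = 0" for d w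
    using that
  proof (induction d arbitrary: w)
    case 0
    then show ?case by (simp add: poly_eq_iff)
  next
    case (Suc d)
    define c where "c i = coeff (w i) 0" for i
    define w' where "w' i = poly_shift 1 (w i)" for i
    have w: "w i = pCons (c i) (w' i)" for i
      by (auto simp: poly_eq_iff c_def w'_def coeff_pCons coeff_poly_shift split: nat.split)
    let ?r = "lc g n (monom 1) w'"
    have sum: "(\<Sum>i<n. monom (c i) i) + h_op g ?r = 0"
      using Suc.prems(2) by (simp add: w lc_pCons smult_monom)
    have "?r = 0"
    proof (rule ccontr)
      assume r: "?r \<noteq> 0"
      then have "coeff (h_op g ?r) (degree ?r + n) \<noteq> 0"
        using degree_h_op[OF r, of g] g by (auto simp: leading_coeff_0_iff[of g])
      moreover have "coeff ((\<Sum>i<n. monom (c i) i) + h_op g ?r) (degree ?r + n) = 0"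
        unfolding sum by simp
      ultimately show False
        by (simp add: coeff_sum_monom)
    qed
    moreover have "\<forall>i<n. \<forall>k\<ge>d. coeff (w' i) k = 0"
      using Suc.prems(1) by (simp add: w'_def coeff_poly_shift)
    ultimately have "\<forall>i<n. w' i = 0"
      using Suc.IH by blast
    moreover have "c i = 0" if "i < n" for i
      using sum \<open>?r = 0\<close> coeff_sum_monom[of c n i] that by simp
    ultimately show ?case by (simp add: w)
  qed
  moreover have "\<forall>i<n. \<forall>k\<ge>Suc (\<Sum>i<n. degree (w i)). coeff (w i) k = 0"
  proof (intro allI impI)
    fix i k assume "i < n" and k: "Suc (\<Sum>i<n. degree (w i)) \<le> k"
    then have "degree (w i) \<le> (\<Sum>i<n. degree (w i))"
      by (intro member_le_sum) auto
    with k show "coeff (w i) k = 0"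
      by (intro coeff_eq_0) simp
  qed
  ultimately show ?thesis using assms by blast
qed

text \<open>The induction hypothesis is used twice, for the remainder \<open>p - h_op g r\<close>
  and for the quotient \<open>r\<close>; both have smaller degree than p.\<close>

lemma lc_monom_surj:
  assumes g: "degree g = n" "n \<ge> 2"
  shows "\<exists>w. lc g n (monom 1) w = p"
proof (induction "degree p" arbitrary: p rule: less_induct)
  case less
  show ?case
  proof (cases "degree p < n")
    case True
    have "lc g n (monom 1) (\<lambda>i. [:coeff p i:]) = (\<Sum>i<n. monom (coeff p i) i)"
      by (simp add: lc_def smult_monom)
    also have "\<dots> = p"
      using True by (auto simp: poly_eq_iff coeff_sum_monom coeff_eq_0)
    finally show ?thesis by blast
  next
    case False
    \<comment> \<open>The scalar inverts the factor n a_n / 2 of \<open>degree_h_op\<close>, so that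
      h r and p share their leading term.\<close>
    define r where "r = monom (2 * lead_coeff p / (of_nat n * lead_coeff g)) (degree p - n)"
    have nz: "p \<noteq> 0" "lead_coeff g \<noteq> 0"
      using False g by auto
    then have "r \<noteq> 0" and dr: "degree r = degree p - n"
      using g by (auto simp: r_def degree_monom_eq monom_eq_0_iff)
    note deg = degree_h_op[OF \<open>r \<noteq> 0\<close>, of g]
    have "coeff (h_op g r) (degree p) = lead_coeff p"
      using deg(2) dr False g nz by (simp add: r_def degree_monom_eq)
    moreover have "degree (h_op g r) = degree p"
      using deg(1) dr False g by simp
    moreover have "degree p > 0" using False g by simp
    ultimately have "degree (p - h_op g r) < degree p"
      by (intro degree_lessI) (auto intro: degree_diff_le)
    then obtain w1 where w1: "lc g n (monom 1) w1 = p - h_op g r"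
      using less by blast
    have "degree r < degree p"
      using dr False g by simp
    then obtain w2 where w2: "lc g n (monom 1) w2 = r"
      using less by blast
    have "lc g n (monom 1) (\<lambda>i. w1 i + pCons 0 (w2 i)) = p"
      by (simp only: lc_add lc_pCons w1 w2) simp
    then show ?thesis by blast
  qed
qed

section \<open>Invertible polynomial matrices\<close>

text \<open>Solutions for the unit vectors form a right inverse, which over a commutative ring is
  two-sided. No inverse matrix has to be written down.\<close>

lemma GL_polyI:
  assumes A: "A \<in> carrier_mat n n"
    and solve: "\<And>y. \<exists>x. \<forall>i<n. (\<Sum>j<n. A $$ (i, j) * x j) = y i"
  shows "A \<in> GL_poly n"
proof -
  have "\<forall>k. \<exists>x. \<forall>i<n. (\<Sum>j<n. A $$ (i, j) * x j) = (if i = k then 1 else 0)"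
    by (intro allI solve)
  from choice[OF this] obtain X
    where X: "\<And>k i. i < n \<Longrightarrow> (\<Sum>j<n. A $$ (i, j) * X k j) = (if i = k then 1 else 0)"
    by blast
  define B where "B = mat n n (\<lambda>(j, k). X k j)"
  have B: "B \<in> carrier_mat n n"
    by (simp add: B_def)
  have AB: "A * B = 1\<^sub>m n"
  proof (rule eq_matI)
    fix i k assume "i < dim_row (1\<^sub>m n :: complex poly mat)" "k < dim_col (1\<^sub>m n :: complex poly mat)"
    then show "(A * B) $$ (i, k) = 1\<^sub>m n $$ (i, k)"
      using A X[of i k] by (simp add: B_def scalar_prod_def atLeast0LessThan)
  qed (use A B in auto)
  \<comment> \<open>Multiplying A B = 1 by the adjugate expresses B as det B times the adjugate,
    which also inverts A from the left.\<close>
  have "B * A = 1\<^sub>m n"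
  proof -
    let ?C = "adj_mat A"
    have det: "det A * det B = 1"
      using det_mult[OF A B] AB by simp
    have C: "?C \<in> carrier_mat n n" "?C * A = det A \<cdot>\<^sub>m 1\<^sub>m n"
      using adj_mat[OF A] by auto
    have "B = det B \<cdot>\<^sub>m (det A \<cdot>\<^sub>m B)"
      using det by (intro eq_matI) (auto simp: mult.commute simp flip: mult.assoc)
    also have "det A \<cdot>\<^sub>m B = ?C * A * B"
      using B by (simp add: C(2) mult_smult_assoc_mat[of _ n n _ n])
    also have "\<dots> = ?C * 1\<^sub>m n"
      unfolding AB[symmetric] using A B C(1) by (intro assoc_mult_mat)
    finally have "B = det B \<cdot>\<^sub>m ?C"
      using C by simp
    then have "B * A = det B \<cdot>\<^sub>m (?C * A)"
      using A C(1) mult_smult_assoc_mat[of ?C n n A n "det B"] by simp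
    also have "\<dots> = 1\<^sub>m n"
      using det by (intro eq_matI) (auto simp: C(2) mult.commute)
    finally show ?thesis .
  qed
  then show ?thesis
    using A B AB unfolding GL_poly_def Units_def by (auto simp: ring_mat_simps)
qed

lemma GL_polyD:
  assumes "A \<in> GL_poly n"
  shows "A \<in> carrier_mat n n" "GL_inv n A \<in> carrier_mat n n" "GL_inv n A \<in> GL_poly n"
    "A * GL_inv n A = 1\<^sub>m n" "GL_inv n A * A = 1\<^sub>m n" "GL_inv n (GL_inv n A) = A"
proof -
  interpret ring "poly_mat_ring n" by (rule ring_mat)
  show "A \<in> carrier_mat n n" "GL_inv n A \<in> carrier_mat n n" "GL_inv n A \<in> GL_poly n"
    "A * GL_inv n A = 1\<^sub>m n" "GL_inv n A * A = 1\<^sub>m n" "GL_inv n (GL_inv n A) = A"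
    using assms Units_closed Units_inv_closed Units_r_inv Units_l_inv Units_inv_Units Units_inv_inv
    unfolding GL_poly_def GL_inv_def by (auto simp: ring_mat_simps)
qed

lemma GL_inv_eqI:
  assumes "A \<in> carrier_mat n n" "B \<in> carrier_mat n n" "A * B = 1\<^sub>m n" "B * A = 1\<^sub>m n"
  shows "A \<in> GL_poly n" "GL_inv n A = B"
proof -
  interpret ring "poly_mat_ring n" by (rule ring_mat)
  show "A \<in> GL_poly n"
    using assms unfolding GL_poly_def Units_def by (auto simp: ring_mat_simps)
  show "GL_inv n A = B"
    using assms unfolding GL_inv_def by (intro inv_char) (auto simp: ring_mat_simps)
qed

lemma GL_poly_mult:
  assumes "A \<in> GL_poly n" "B \<in> GL_poly n"
  shows "A * B \<in> GL_poly n" "GL_inv n (A * B) = GL_inv n B * GL_inv n A"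
proof -
  note A = GL_polyD[OF assms(1)] and B = GL_polyD[OF assms(2)]
  have "A * B * (GL_inv n B * GL_inv n A) = A * (B * GL_inv n B) * GL_inv n A"
    using A(1,2) B(1,2) by (simp add: assoc_mult_mat[of _ n n _ n _ n])
  moreover have "GL_inv n B * GL_inv n A * (A * B) = GL_inv n B * (GL_inv n A * A) * B"
    using A(1,2) B(1,2) by (simp add: assoc_mult_mat[of _ n n _ n _ n])
  ultimately show "A * B \<in> GL_poly n" "GL_inv n (A * B) = GL_inv n B * GL_inv n A"
    using A(1,2,4,5) B(1,2,4,5) GL_inv_eqI[of "A * B" n "GL_inv n B * GL_inv n A"] by simp_all
qed

lemma GL_poly_map_shift:
  assumes "A \<in> GL_poly n"
  shows "map_mat (shift c) A \<in> GL_poly n"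
proof -
  note A = GL_polyD[OF assms]
  have "map_mat (shift c) A * map_mat (shift c) (GL_inv n A) = 1\<^sub>m n"
    "map_mat (shift c) (GL_inv n A) * map_mat (shift c) A = 1\<^sub>m n"
    using A by (simp_all add: map_mat_shift_one flip: map_mat_shift_mult[of _ n n _ n])
  then show ?thesis
    using A unfolding GL_poly_def Units_def
    by (auto simp: ring_mat_simps intro!: bexI[of _ "map_mat (shift c) (GL_inv n A)"])
qed

section \<open>Transfer of the module structure\<close>

lemma act_of_simps [simp]:
  "carrier (act_of V e f h) = carrier V"
  "zero (act_of V e f h) = zero V"
  "add (act_of V e f h) = add V"
  "module.smult (act_of V e f h) = module.smult V"
  "act (act_of V e f h) = (\<lambda>x v. x $$ (0,1) \<odot>\<^bsub>V\<^esub> e v \<oplus>\<^bsub>V\<^esub> x $$ (1,0) \<odot>\<^bsub>V\<^esub> f v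
    \<oplus>\<^bsub>V\<^esub> (2 * x $$ (0,0)) \<odot>\<^bsub>V\<^esub> h v)"
  by (simp_all add: act_of_def module.defs sl2_mod.defs)

lemma T3_simps [simp]:
  "carrier (T3 g) = UNIV"
  "zero (T3 g) = 0"
  "add (T3 g) = (+)"
  "module.smult (T3 g) = Polynomial.smult"
  "act (T3 g) x p = Polynomial.smult (x $$ (0,1)) (e_op p) + Polynomial.smult (x $$ (1,0)) (f_op g p)
    + Polynomial.smult (2 * x $$ (0,0)) (h_op g p)"
  by (simp_all add: T3_def exp_space_def e_op_def f_op_def h_op_def)

lemma M_mod_simps [simp]:
  "carrier (M_mod n E F) = carrier_vec n"
  "zero (M_mod n E F) = 0\<^sub>v n"
  "add (M_mod n E F) = (+)"
  "module.smult (M_mod n E F) = (\<lambda>c w. [:c:] \<cdot>\<^sub>v w)"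
  "act (M_mod n E F) x w = [:x $$ (0,1):] \<cdot>\<^sub>v (E *\<^sub>v map_vec sigma w)
    + [:x $$ (1,0):] \<cdot>\<^sub>v (F *\<^sub>v map_vec sigma_inv w) + [:2 * x $$ (0,0):] \<cdot>\<^sub>v ([:0, 1:] \<cdot>\<^sub>v w)"
  by (simp_all add: M_mod_def poly_vec_space_def)

lemma lie_bracket_index:
  assumes "x \<in> sl2" "y \<in> sl2"
  shows "lie_bracket x y $$ (0,1) = 2 * (x $$ (0,0) * y $$ (0,1) - y $$ (0,0) * x $$ (0,1))"
    "lie_bracket x y $$ (1,0) = 2 * (y $$ (0,0) * x $$ (1,0) - x $$ (0,0) * y $$ (1,0))"
    "lie_bracket x y $$ (0,0) = x $$ (0,1) * y $$ (1,0) - y $$ (0,1) * x $$ (1,0)"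
proof -
  have x: "x \<in> carrier_mat 2 2" "x $$ (1,1) = - x $$ (0,0)"
    and y: "y \<in> carrier_mat 2 2" "y $$ (1,1) = - y $$ (0,0)"
    using assms by (auto simp: sl2_def add_eq_0_iff)
  have 2: "{0..<2} = {0, 1::nat}" by auto
  show "lie_bracket x y $$ (0,1) = 2 * (x $$ (0,0) * y $$ (0,1) - y $$ (0,0) * x $$ (0,1))"
    "lie_bracket x y $$ (1,0) = 2 * (y $$ (0,0) * x $$ (1,0) - x $$ (0,0) * y $$ (1,0))"
    "lie_bracket x y $$ (0,0) = x $$ (0,1) * y $$ (1,0) - y $$ (0,1) * x $$ (1,0)"
    using x y by (auto simp: lie_bracket_def scalar_prod_def 2 algebra_simps)
qed

section \<open>Module axioms for T3 g and M(E,F)\<close>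

lemma module_T3: "Module.module class_ring (T3 g)"
proof (rule moduleI)
  show "cring (class_ring :: complex ring)"
    by unfold_locales
  show "abelian_group (T3 g)"
    by (rule abelian_groupI) (auto intro: exI[of _ "- _"] simp: add_eq_0_iff)
qed (simp_all add: class_ring_simps smult_add_left smult_add_right)

lemma module_M_mod: "Module.module class_ring (M_mod n E F)"
proof (rule moduleI)
  show "cring (class_ring :: complex ring)"
    by unfold_locales
  show "abelian_group (M_mod n E F)"
  proof (rule abelian_groupI)
    fix w assume "w \<in> carrier (M_mod n E F)"
    then show "\<exists>y\<in>carrier (M_mod n E F). y \<oplus>\<^bsub>M_mod n E F\<^esub> w = \<zero>\<^bsub>M_mod n E F\<^esub>"
      by (intro bexI[of _ "- w"]) auto
  qed (auto simp: comm_add_vec)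
qed (auto simp: class_ring_simps smult_add_left algebra_simps intro!: eq_vecI)

lemma sl2_module_T3: "sl2_module (T3 g)"
proof -
  interpret Module.module class_ring "T3 g" by (rule module_T3)
  have neg: "\<ominus>\<^bsub>T3 g\<^esub> p = - p" for p
    using M.minus_equality[of "- p" p] by simp
  show ?thesis
  proof unfold_locales
    fix x y p assume xy: "x \<in> sl2" "y \<in> sl2"
    then have c: "x \<in> carrier_mat 2 2" "y \<in> carrier_mat 2 2"
      by (auto simp: sl2_def)
    show "act (T3 g) (x + y) p = act (T3 g) x p \<oplus>\<^bsub>T3 g\<^esub> act (T3 g) y p"
      using c by (simp add: smult_add_left algebra_simps)
    show "act (T3 g) (lie_bracket x y) p
        = act (T3 g) x (act (T3 g) y p) \<ominus>\<^bsub>T3 g\<^esub> act (T3 g) y (act (T3 g) x p)"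
      by (rule poly_extI)
        (simp add: a_minus_def neg op_commutation lie_bracket_index[OF xy] algebra_simps
           del: One_nat_def)
  next
    fix c x p assume "x \<in> sl2"
    then have c: "x \<in> carrier_mat 2 2"
      by (auto simp: sl2_def)
    show "act (T3 g) (c \<cdot>\<^sub>m x) p = c \<odot>\<^bsub>T3 g\<^esub> act (T3 g) x p"
      using c by (simp add: smult_add_right mult.left_commute)
    show "act (T3 g) x (c \<odot>\<^bsub>T3 g\<^esub> p) = c \<odot>\<^bsub>T3 g\<^esub> act (T3 g) x p"
      by (simp add: smult_add_right mult.commute)
  qed (simp_all add: smult_add_right)
qed

text \<open>Both sides of each axiom have the same image under the injective intertwiner, hence
  agree. In this way M(E,F) is recognised as a module.\<close>

lemma sl2_module_transfer:
  assumes V: "sl2_module V" and W: "Module.module (class_ring :: complex ring) W"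
    and hom: "\<phi> \<in> LinearCombinations.module_hom (class_ring :: complex ring) W V"
    and inj: "inj_on \<phi> (carrier W)"
    and closed: "\<And>x w. x \<in> sl2 \<Longrightarrow> w \<in> carrier W \<Longrightarrow> act W x w \<in> carrier W"
    and comm: "\<And>x w. x \<in> sl2 \<Longrightarrow> w \<in> carrier W \<Longrightarrow> \<phi> (act W x w) = act V x (\<phi> w)"
  shows "sl2_module W"
proof -
  interpret V: sl2_module V by fact
  interpret W: Module.module "class_ring :: complex ring" W by fact
  interpret mod_hom "class_ring :: complex ring" W V \<phi>
    by unfold_locales fact
  have C: "c \<in> carrier class_ring" for c :: complex
    by (simp add: class_ring_simps)
  have neg: "\<phi> (u \<ominus>\<^bsub>W\<^esub> w) = \<phi> u \<ominus>\<^bsub>V\<^esub> \<phi> w" if "u \<in> carrier W" "w \<in> carrier W" for u w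
    using that by (simp add: a_minus_def f_neg)
  show ?thesis
  proof unfold_locales
    fix x y w assume *: "x \<in> sl2" "y \<in> sl2" "w \<in> carrier W"
    then have sl2: "x + y \<in> sl2" "lie_bracket x y \<in> sl2"
      by (auto simp: sl2_def lie_bracket_def scalar_prod_def numeral_2_eq_2 algebra_simps)
    show "act W (x + y) w = act W x w \<oplus>\<^bsub>W\<^esub> act W y w"
      using * sl2 by (intro inj_onD[OF inj]) (simp_all add: comm closed V.act_add_left)
    show "act W (lie_bracket x y) w = act W x (act W y w) \<ominus>\<^bsub>W\<^esub> act W y (act W x w)"
      using * sl2 by (intro inj_onD[OF inj]) (simp_all add: comm closed V.act_bracket neg)
  next
    fix x w w' assume "x \<in> sl2" "w \<in> carrier W" "w' \<in> carrier W"
    then show "act W x (w \<oplus>\<^bsub>W\<^esub> w') = act W x w \<oplus>\<^bsub>W\<^esub> act W x w'"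
      by (intro inj_onD[OF inj]) (simp_all add: comm closed V.act_add_right)
  next
    fix c x w assume *: "x \<in> sl2" "w \<in> carrier W"
    then have "c \<cdot>\<^sub>m x \<in> sl2"
      by (auto simp: sl2_def simp flip: distrib_left)
    with * show "act W (c \<cdot>\<^sub>m x) w = c \<odot>\<^bsub>W\<^esub> act W x w"
      by (intro inj_onD[OF inj]) (simp_all add: comm closed C V.act_smult_left)
    show "act W x (c \<odot>\<^bsub>W\<^esub> w) = c \<odot>\<^bsub>W\<^esub> act W x w"
      using * by (intro inj_onD[OF inj]) (simp_all add: comm closed C V.act_smult_right)
  qed (rule closed)
qed

text \<open>The natural map leads from coordinates to the module, against the direction wanted.
  Closure of the action on W is assumed because W is only here found to be an sl(2)-module.\<close>

lemma sl2_isomorphic_inverseI: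
  assumes V: "sl2_module V" and W: "Module.module (class_ring :: complex ring) W"
    and hom: "\<phi> \<in> LinearCombinations.module_hom (class_ring :: complex ring) W V"
    and bij: "bij_betw \<phi> (carrier W) (carrier V)"
    and closed: "\<And>x w. x \<in> sl2 \<Longrightarrow> w \<in> carrier W \<Longrightarrow> act W x w \<in> carrier W"
    and comm: "\<And>x w. x \<in> sl2 \<Longrightarrow> w \<in> carrier W \<Longrightarrow> \<phi> (act W x w) = act V x (\<phi> w)"
  shows "V \<simeq> W"
proof -
  have inj: "inj_on \<phi> (carrier W)"
    using bij by (rule bij_betw_imp_inj_on)
  interpret V: sl2_module V by fact
  interpret W: sl2_module W
    by (rule sl2_module_transfer[OF V W hom inj closed comm])
  let ?\<psi> = "inv_into (carrier W) \<phi>"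
  have \<psi>: "?\<psi> v \<in> carrier W" "\<phi> (?\<psi> v) = v" if "v \<in> carrier V" for v
    using bij that by (auto simp: bij_betw_def inv_into_into f_inv_into_f)
  have \<psi>I: "?\<psi> v = w" if "w \<in> carrier W" "\<phi> w = v" for v w
    using that inj by (auto simp: inv_into_f_f)
  have "?\<psi> \<in> LinearCombinations.module_hom (class_ring :: complex ring) V W"
    using \<psi> hom unfolding LinearCombinations.module_hom_def
    by (auto intro!: \<psi>I)
  moreover have "bij_betw ?\<psi> (carrier V) (carrier W)"
    using bij by (rule bij_betw_inv_into)
  moreover have "?\<psi> (act V x v) = act W x (?\<psi> v)" if "x \<in> sl2" "v \<in> carrier V" for x v
    using that \<psi> by (intro \<psi>I) (auto simp: comm closed)
  ultimately show ?thesis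
    unfolding sl2_isomorphic_def using V W.sl2_module_axioms by blast
qed

section \<open>From a basis over C[h] to an isomorphism with M(E,F)\<close>

lemma T3_isomorphic_M_mod:
  fixes g :: "complex poly" and n :: nat and v :: "nat \<Rightarrow> complex poly"
  defines "\<Phi> \<equiv> \<lambda>w. lc g n v (vec_index w)"
  assumes E: "E \<in> carrier_mat n n" and F: "F \<in> carrier_mat n n"
    and bij: "bij_betw \<Phi> (carrier_vec n) UNIV"
    and comm_e: "\<And>w. w \<in> carrier_vec n \<Longrightarrow> \<Phi> (E *\<^sub>v map_vec sigma w) = e_op (\<Phi> w)"
    and comm_f: "\<And>w. w \<in> carrier_vec n \<Longrightarrow> \<Phi> (F *\<^sub>v map_vec sigma_inv w) = f_op g (\<Phi> w)"
  shows "T3 g \<simeq> M_mod n E F"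
proof (rule sl2_isomorphic_inverseI)
  have add: "\<Phi> (w + w') = \<Phi> w + \<Phi> w'" if "w \<in> carrier_vec n" "w' \<in> carrier_vec n" for w w'
    using that unfolding \<Phi>_def lc_add[symmetric] by (intro lc_cong) auto
  \<comment> \<open>Besides the scalars this covers h, which acts on coordinates as multiplication
    by \<open>[:0, 1:]\<close>.\<close>
  have smult: "\<Phi> (q \<cdot>\<^sub>v w) = h_act g q (\<Phi> w)" if "w \<in> carrier_vec n" for q w
    using that unfolding \<Phi>_def lc_mult[symmetric] by (intro lc_cong) auto
  show "\<Phi> \<in> LinearCombinations.module_hom (class_ring :: complex ring) (M_mod n E F) (T3 g)"
    unfolding LinearCombinations.module_hom_def by (auto simp: add smult)
  show "bij_betw \<Phi> (carrier (M_mod n E F)) (carrier (T3 g))"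
    using bij by simp
  fix x w assume "x \<in> sl2" and w: "w \<in> carrier (M_mod n E F)"
  then have c: "E *\<^sub>v map_vec sigma w \<in> carrier_vec n" "F *\<^sub>v map_vec sigma_inv w \<in> carrier_vec n" "w \<in> carrier_vec n"
    using E F by auto
  then show "act (M_mod n E F) x w \<in> carrier (M_mod n E F)"
    by simp
  show "\<Phi> (act (M_mod n E F) x w) = act (T3 g) x (\<Phi> w)"
    using c by (simp add: add smult comm_e comm_f del: One_nat_def)
qed (rule sl2_module_T3 module_M_mod)+

lemma lc_mult_mat_vec:
  assumes "A \<in> carrier_mat n n" "w \<in> carrier_vec n"
  shows "lc g n v (vec_index (A *\<^sub>v w)) = lc g n (\<lambda>j. lc g n v (\<lambda>i. A $$ (i, j))) (vec_index w)"
  unfolding lc_linear_map[symmetric] using assms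
  by (intro lc_cong) (auto simp: scalar_prod_def atLeast0LessThan)

lemma lc_mult_mat:
  assumes "A \<in> carrier_mat n n" "B \<in> carrier_mat n n" "j < n"
  shows "lc g n v (\<lambda>i. (A * B) $$ (i, j)) = lc g n (\<lambda>k. lc g n v (\<lambda>i. A $$ (i, k))) (\<lambda>k. B $$ (k, j))"
  unfolding lc_linear_map[symmetric] using assms
  by (intro lc_cong) (auto simp: scalar_prod_def atLeast0LessThan)

lemma e_op_lc: "e_op (lc g n v w) = lc g n (\<lambda>j. e_op (v j)) (\<lambda>j. sigma (w j))"
  by (simp add: lc_def e_op_sum e_op_h_act)

text \<open>As e q(h) = sigma(q)(h) e, agreement of E with e on the \<open>v j\<close> extends to
  all coordinate vectors. The matrix F then follows by cancelling e.\<close>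

lemma T3_isomorphic_M_modI:
  assumes E: "E \<in> carrier_mat n n" and F: "F \<in> carrier_mat n n"
    and EF: "E * map_mat sigma F = sigma (lam (1/4)) \<cdot>\<^sub>m 1\<^sub>m n"
    and bij: "bij_betw (\<lambda>w. lc g n v (vec_index w)) (carrier_vec n) UNIV"
    and col: "\<And>j. j < n \<Longrightarrow> lc g n v (\<lambda>i. E $$ (i, j)) = e_op (v j)"
  shows "T3 g \<simeq> M_mod n E F"
proof (rule T3_isomorphic_M_mod[OF E F bij])
  show e: "lc g n v (vec_index (E *\<^sub>v map_vec sigma w)) = e_op (lc g n v (vec_index w))"
    if "w \<in> carrier_vec n" for w
    using that E by (simp add: lc_mult_mat_vec e_op_lc) (intro lc_cong, auto simp: col)
  fix w :: "complex poly vec" assume w: "w \<in> carrier_vec n"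
  let ?Fw = "F *\<^sub>v map_vec sigma_inv w"
  have "map_vec sigma ?Fw = map_mat sigma F *\<^sub>v map_vec sigma (map_vec sigma_inv w)"
    using map_vec_shift_mult[of F n n "map_vec sigma_inv w" "-1"] F w by (simp add: sigma_def)
  also have "map_vec sigma (map_vec sigma_inv w) = w"
    by (intro eq_vecI) (auto simp: sigma_inverses)
  finally have "E *\<^sub>v map_vec sigma ?Fw = (E * map_mat sigma F) *\<^sub>v w"
    using E F w by (simp add: assoc_mult_mat_vec[of _ n n _ n])
  also have "\<dots> = sigma (lam (1/4)) \<cdot>\<^sub>v w"
    using w unfolding EF by (intro eq_vecI) (auto simp: scalar_prod_def if_distrib[of "\<lambda>x. _ * x * _"] cong: if_cong)
  finally have EF_w: "E *\<^sub>v map_vec sigma ?Fw = sigma (lam (1/4)) \<cdot>\<^sub>v w" .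
  have "?Fw \<in> carrier_vec n"
    using F w by simp
  from e[OF this] have "e_op (lc g n v (vec_index ?Fw)) = lc g n v (vec_index (sigma (lam (1/4)) \<cdot>\<^sub>v w))"
    unfolding EF_w by (rule sym)
  also have "\<dots> = lc g n v (\<lambda>i. sigma (lam (1/4)) * w $ i)"
    using w by (intro lc_cong) auto
  also have "\<dots> = e_op (f_op g (lc g n v (vec_index w)))"
    by (simp only: lc_mult h_act_sigma_lam)
  finally show "lc g n v (vec_index ?Fw) = f_op g (lc g n v (vec_index w))"
    by (rule e_op_inj)
qed

section \<open>Invertibility of matrices in block form\<close>

lemma sum_lessThan_SS: "(\<Sum>i<Suc (Suc m). f i) = f 0 + f 1 + (\<Sum>k<m. f (Suc (Suc k)))" for f :: "nat \<Rightarrow> 'a::comm_monoid_add"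
  by (simp only: sum.lessThan_Suc_shift add.assoc One_nat_def)

lemma lc_SS: "lc g (Suc (Suc m)) v w = h_act g (w 0) (v 0) + h_act g (w 1) (v 1)
    + (\<Sum>k<m. h_act g (w (Suc (Suc k))) (v (Suc (Suc k))))"
  by (simp only: lc_def sum_lessThan_SS)

text \<open>The shape of L: zero above c I in the first m columns, and a 2 x 2 block with constant
  determinant d at the top of the last two.\<close>

lemma GL_poly_antiblockI:
  assumes A: "A \<in> carrier_mat (Suc (Suc m)) (Suc (Suc m))"
    and top: "\<And>j. j < m \<Longrightarrow> A $$ (0, j) = 0" "\<And>j. j < m \<Longrightarrow> A $$ (1, j) = 0"
    and diag: "\<And>k j. k < m \<Longrightarrow> j < m \<Longrightarrow> A $$ (Suc (Suc k), j) = (if j = k then [:c:] else 0)"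
    and c: "c \<noteq> 0"
    and det: "A $$ (0, m) * A $$ (1, Suc m) - A $$ (0, Suc m) * A $$ (1, m) = [:d:]" "d \<noteq> 0"
  shows "A \<in> GL_poly (Suc (Suc m))"
proof (rule GL_polyI[OF A])
  fix y :: "nat \<Rightarrow> complex poly"
  \<comment> \<open>Cramer's rule for the 2 x 2 block; the remaining unknowns follow by back
    substitution.\<close>
  define xm where "xm = Polynomial.smult (1/d) (y 0 * A $$ (1, Suc m) - y 1 * A $$ (0, Suc m))"
  define xm' where "xm' = Polynomial.smult (1/d) (y 1 * A $$ (0, m) - y 0 * A $$ (1, m))"
  define x where "x j = (if j = m then xm else if j = Suc m then xm'
    else Polynomial.smult (1/c) (y (Suc (Suc j)) - A $$ (Suc (Suc j), m) * xm - A $$ (Suc (Suc j), Suc m) * xm'))" for j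
  have split: "(\<Sum>j<Suc (Suc m). A $$ (i, j) * x j) = (\<Sum>j<m. A $$ (i, j) * x j) + A $$ (i, m) * xm + A $$ (i, Suc m) * xm'" for i
    by (simp add: x_def)
  have d: "[:1/d:] * (A $$ (0, m) * A $$ (1, Suc m) - A $$ (0, Suc m) * A $$ (1, m)) = 1"
    unfolding det using det(2) by (simp add: one_pCons)
  have smult_eq: "Polynomial.smult e p = [:e:] * p" for e p by simp
  have 0: "A $$ (0, m) * xm + A $$ (0, Suc m) * xm' = y 0"
  proof -
    have "A $$ (0, m) * xm + A $$ (0, Suc m) * xm'
        = [:1/d:] * (A $$ (0, m) * A $$ (1, Suc m) - A $$ (0, Suc m) * A $$ (1, m)) * y 0"
      unfolding xm_def xm'_def smult_eq by (simp only: algebra_simps)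
    then show ?thesis unfolding d by simp
  qed
  have 1: "A $$ (1, m) * xm + A $$ (1, Suc m) * xm' = y 1"
  proof -
    have "A $$ (1, m) * xm + A $$ (1, Suc m) * xm'
        = [:1/d:] * (A $$ (0, m) * A $$ (1, Suc m) - A $$ (0, Suc m) * A $$ (1, m)) * y 1"
      unfolding xm_def xm'_def smult_eq by (simp only: algebra_simps)
    then show ?thesis unfolding d by simp
  qed
  have "(\<Sum>j<Suc (Suc m). A $$ (i, j) * x j) = y i" if "i < Suc (Suc m)" for i
  proof -
    consider "i = 0" | "i = 1" | k where "i = Suc (Suc k)" "k < m"
      using \<open>i < Suc (Suc m)\<close> by (metis One_nat_def Suc_less_eq not0_implies_Suc)
    then show ?thesis
    proof cases
      case 1
      then show ?thesis unfolding split using top(1) 0 by simp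
    next
      case 2
      then show ?thesis unfolding split using top(2) 1 by simp
    next
      case 3
      have "(\<Sum>j<m. A $$ (i, j) * x j) = (\<Sum>j<m. if j = k then [:c:] * x k else 0)"
        using 3 diag by (intro sum.cong) auto
      also have "\<dots> = [:c:] * x k"
        using 3 by simp
      finally show ?thesis
        unfolding split using 3 c by (simp add: x_def)
    qed
  qed
  then show "\<exists>x. \<forall>i<Suc (Suc m). (\<Sum>j<Suc (Suc m). A $$ (i, j) * x j) = y i"
    by blast
qed

text \<open>The shape of R: block diagonal, with a 2 x 2 block solved by Cramer's rule and a scalar
  block.\<close>

lemma GL_poly_blockI:
  assumes A: "A \<in> carrier_mat (Suc (Suc m)) (Suc (Suc m))"
    and top: "\<And>j. j < m \<Longrightarrow> A $$ (0, Suc (Suc j)) = 0" "\<And>j. j < m \<Longrightarrow> A $$ (1, Suc (Suc j)) = 0"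
    and rest: "\<And>k j. k < m \<Longrightarrow> j < Suc (Suc m) \<Longrightarrow> A $$ (Suc (Suc k), j) = (if j = Suc (Suc k) then [:c:] else 0)"
    and c: "c \<noteq> 0"
    and det: "A $$ (0, 0) * A $$ (1, 1) - A $$ (0, 1) * A $$ (1, 0) = [:d:]" "d \<noteq> 0"
  shows "A \<in> GL_poly (Suc (Suc m))"
proof (rule GL_polyI[OF A])
  fix y :: "nat \<Rightarrow> complex poly"
  define x where "x j = (if j = 0 then Polynomial.smult (1/d) (y 0 * A $$ (1, 1) - y 1 * A $$ (0, 1))
    else if j = 1 then Polynomial.smult (1/d) (y 1 * A $$ (0, 0) - y 0 * A $$ (1, 0))
    else Polynomial.smult (1/c) (y j))" for j
  have d: "[:1/d:] * (A $$ (0, 0) * A $$ (1, 1) - A $$ (0, 1) * A $$ (1, 0)) = 1"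
    unfolding det using det(2) by (simp add: one_pCons)
  have smult_eq: "Polynomial.smult e p = [:e:] * p" for e p by simp
  have x: "x 0 = Polynomial.smult (1/d) (y 0 * A $$ (1, 1) - y 1 * A $$ (0, 1))"
    "x 1 = Polynomial.smult (1/d) (y 1 * A $$ (0, 0) - y 0 * A $$ (1, 0))"
    by (simp_all add: x_def)
  have 0: "A $$ (0, 0) * x 0 + A $$ (0, 1) * x 1 = y 0"
  proof -
    have "A $$ (0, 0) * x 0 + A $$ (0, 1) * x 1
        = [:1/d:] * (A $$ (0, 0) * A $$ (1, 1) - A $$ (0, 1) * A $$ (1, 0)) * y 0"
      unfolding x smult_eq by (simp only: algebra_simps)
    then show ?thesis unfolding d by simp
  qed
  have 1: "A $$ (1, 0) * x 0 + A $$ (1, 1) * x 1 = y 1"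
  proof -
    have "A $$ (1, 0) * x 0 + A $$ (1, 1) * x 1
        = [:1/d:] * (A $$ (0, 0) * A $$ (1, 1) - A $$ (0, 1) * A $$ (1, 0)) * y 1"
      unfolding x smult_eq by (simp only: algebra_simps)
    then show ?thesis unfolding d by simp
  qed
  have "(\<Sum>j<Suc (Suc m). A $$ (i, j) * x j) = y i" if "i < Suc (Suc m)" for i
  proof -
    consider "i = 0" | "i = 1" | k where "i = Suc (Suc k)" "k < m"
      using \<open>i < Suc (Suc m)\<close> by (metis One_nat_def Suc_less_eq not0_implies_Suc)
    then show ?thesis
    proof cases
      case 1
      then show ?thesis unfolding sum_lessThan_SS using top(1) 0 by simp
    next
      case 2
      then show ?thesis unfolding sum_lessThan_SS using top(2) 1 by simp
    next
      case 3
      have "(\<Sum>j<Suc (Suc m). A $$ (i, j) * x j) = (\<Sum>j<Suc (Suc m). if j = i then [:c:] * x i else 0)"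
        using 3 rest by (intro sum.cong) auto
      also have "\<dots> = [:c:] * x i"
        using \<open>i < Suc (Suc m)\<close> by (simp only: sum.delta finite_lessThan lessThan_iff if_True)
      finally show ?thesis
        using 3 c by (simp add: x_def)
    qed
  qed
  then show "\<exists>x. \<forall>i<Suc (Suc m). (\<Sum>j<Suc (Suc m). A $$ (i, j) * x j) = y i"
    by blast
qed

text \<open>L takes monomial coordinates to coordinates in v, up to the factor s. Since L is
  invertible and s is nonzero, freeness on the monomials makes v a basis as well.\<close>

lemma bij_betw_lc:
  assumes g: "degree g = n" "n \<ge> 2"
    and L: "L \<in> GL_poly n" and s: "s \<noteq> 0"
    and col: "\<And>j. j < n \<Longrightarrow> lc g n v (\<lambda>i. L $$ (i, j)) = Polynomial.smult s (monom 1 j)"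
  shows "bij_betw (\<lambda>w. lc g n v (vec_index w)) (carrier_vec n) UNIV"
proof -
  note L' = GL_polyD[OF L]
  have Lw: "lc g n v (vec_index (L *\<^sub>v w)) = Polynomial.smult s (lc g n (monom 1) (vec_index w))"
    if "w \<in> carrier_vec n" for w
    unfolding lc_mult_mat_vec[OF L'(1) that] lc_smult_left[symmetric]
    by (intro lc_cong) (auto simp: col)
  have inj: "w = 0\<^sub>v n" if w: "w \<in> carrier_vec n" and 0: "lc g n v (vec_index w) = 0" for w
  proof -
    let ?u = "GL_inv n L *\<^sub>v w"
    have u: "?u \<in> carrier_vec n"
      using L'(2) w by simp
    have Lu: "L *\<^sub>v ?u = w"
      using L' w by (simp flip: assoc_mult_mat_vec[of _ n n _ n])
    have "lc g n (monom 1) (vec_index ?u) = 0"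
      using Lw[OF u] 0 s unfolding Lu by simp
    then have "?u = 0\<^sub>v n"
      using u L'(2) lc_monom_inj[OF g, of "vec_index ?u"] by (intro eq_vecI) auto
    then have "w = L *\<^sub>v 0\<^sub>v n"
      using Lu by simp
    then show ?thesis
      using L'(1) by (intro eq_vecI) auto
  qed
  have "inj_on (\<lambda>w. lc g n v (vec_index w)) (carrier_vec n)"
  proof (rule inj_onI)
    fix w w' :: "complex poly vec"
    assume *: "w \<in> carrier_vec n" "w' \<in> carrier_vec n" "lc g n v (vec_index w) = lc g n v (vec_index w')"
    then have "lc g n v (vec_index (w - w')) = lc g n v (\<lambda>i. w $ i - w' $ i)"
      by (intro lc_cong) auto
    then have "w - w' = 0\<^sub>v n"
      using * by (intro inj) (auto simp: lc_diff)
    then have "(w - w') $ i = 0" if "i < n" for i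
      using that by simp
    then show "w = w'"
      using * by (intro eq_vecI) auto
  qed
  moreover have "\<exists>w\<in>carrier_vec n. p = lc g n v (vec_index w)" for p
  proof -
    \<comment> \<open>Dividing by s compensates the factor that L introduces.\<close>
    obtain w where w: "lc g n (monom 1) w = Polynomial.smult (1/s) p"
      using lc_monom_surj[OF g] by blast
    have "lc g n (monom 1) (vec_index (vec n w)) = lc g n (monom 1) w"
      by (intro lc_cong) auto
    then have "lc g n v (vec_index (L *\<^sub>v vec n w)) = p"
      using s w by (subst Lw) auto
    then show ?thesis
      using L'(1) by (intro bexI[of _ "L *\<^sub>v vec n w"]) auto
  qed
  ultimately show ?thesis
    unfolding bij_betw_def by blast
qed

lemma Pbar_mat_eq:
  "Pbar_mat (1, 0, n - 1) (1/4) = mat_diag (size3 (1, 0, n - 1)) (\<lambda>i. if i = 0 then lam (1/4) else -1)"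
  unfolding Pbar_mat_def
proof (rule the1_equality[OF Pbar_mat_ex1], intro conjI)
  let ?D = "mat_diag (size3 (1, 0, n - 1)) (\<lambda>i. if i = 0 then lam (1/4) else -1) :: complex poly mat"
  show "?D \<in> carrier_mat (size3 (1, 0, n - 1)) (size3 (1, 0, n - 1))" "diagonal_mat ?D"
    by (auto simp: mat_diag_def diagonal_mat_def)
  show "?D * P_mat (1, 0, n - 1) (1/4) = lam (1/4) \<cdot>\<^sub>m 1\<^sub>m (size3 (1, 0, n - 1))"
    unfolding P_mat_def mat_diag_diag
    by (intro eq_matI) (auto simp: mat_diag_def lam_def one_pCons)
qed

section \<open>The basis v\<close>

text \<open>Writing n as \<open>Suc (Suc m)\<close> separates the two exceptional rows and columns
  from the m regular ones.\<close>

locale exp_module =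
  fixes m :: nat and a :: "nat \<Rightarrow> complex" and g :: "complex poly"
  assumes a_n: "a (Suc (Suc m)) \<noteq> 0" and g: "g = (\<Sum>i = 1..Suc (Suc m). monom (a i) i)"
begin

abbreviation n :: nat where "n \<equiv> Suc (Suc m)"

text \<open>\<open>N\<close> and \<open>c\<close> are the two top coefficients of g' and
  \<open>S1\<close> is the rest of g'; \<open>S2\<close> is the polynomial \<open>q\<close> below
  without its top term. The sign \<open>\<epsilon>\<close> unites the two cases for row indices from
  3 on.\<close>

definition N :: complex where "N = of_nat n * a n"
definition c :: complex where "c = of_nat (Suc m) * a (Suc m)"
definition \<epsilon> :: complex where "\<epsilon> = (if a 1 \<noteq> 0 then 1 else -1)"
definition S1 :: "complex poly" where "S1 = (\<Sum>k<m. monom (of_nat (Suc k) * a (Suc k)) k)"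
definition S2 :: "complex poly" where "S2 = (\<Sum>k<m. monom (of_nat (Suc (Suc k)) * a (Suc (Suc k))) k)"
text \<open>This is (g' - a_1) / t.\<close>

definition q :: "complex poly" where "q = S2 + monom N m"
abbreviation g' :: "complex poly" where "g' \<equiv> pderiv g"
abbreviation D :: "complex poly \<Rightarrow> complex poly" where "D \<equiv> exp_deriv g"

text \<open>Found by solving L = base change for v: the columns of L of index at most n - 2 force
  v_i = t^(i-3) for i at least 3, and the last two columns then determine v_1 and v_2
  (indices from 1; the definition counts from 0).\<close>

definition v :: "nat \<Rightarrow> complex poly" where
  "v i = (if i = 0 then
            if a 1 \<noteq> 0 then Polynomial.smult (-1/4) (D g')
            else Polynomial.smult (1/4) (g' + D (pCons 0 g') + D g')
          else if i = 1 then
            if a 1 \<noteq> 0 then Polynomial.smult (1 / a 1) q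
            else Polynomial.smult (1/2) (g' + q)
          else monom 1 (i - 2))"

lemma N_nz: "N \<noteq> 0"
  using a_n by (simp add: N_def del: of_nat_Suc)

lemma coeff_g: "coeff g k = (if 1 \<le> k \<and> k \<le> n then a k else 0)"
  by (simp add: g coeff_sum)

lemma degree_g: "degree g = n"
  using a_n by (intro antisym degree_le le_degree) (auto simp: coeff_g)

lemma g'_eq: "g' = S1 + monom c m + monom N (Suc m)"
  by (rule poly_eqI) (auto simp: coeff_pderiv coeff_g S1_def coeff_sum_monom c_def N_def not_less less_Suc_eq_le)

lemma g'_q: "g' = [:a 1:] + pCons 0 q"
  by (rule poly_eqI)
    (auto simp: coeff_pderiv coeff_g q_def S2_def coeff_sum_monom N_def not_less coeff_pCons less_Suc_eq_le split: nat.splits)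

lemma D_1: "D 1 = g'"
  by (simp add: exp_deriv_def)

text \<open>D applied to g' = a_1 + t q. It relates the term t D q, produced by u(h) acting on q, to
  D g'.\<close>

lemma X_D_q: "pCons 0 (D q) = D g' - Polynomial.smult (a 1) g' - q"
proof -
  have "g' = Polynomial.smult (a 1) 1 + pCons 0 q"
    using g'_q by (simp add: one_pCons)
  then have "D g' = D (Polynomial.smult (a 1) 1 + pCons 0 q)"
    by (rule arg_cong)
  also have "\<dots> = Polynomial.smult (a 1) g' + (q + pCons 0 (D q))"
    by (simp only: exp_deriv_linear D_1 exp_deriv_X_mult)
  finally show ?thesis
    by simp
qed

section \<open>Entries and determinants of L and R\<close>

lemma L_carrier: "L_mat n a \<in> carrier_mat n n"
  by (simp add: L_mat_def mat1_def Let_def)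

lemma R_carrier: "R_mat n a \<in> carrier_mat n n"
  by (simp add: R_mat_def mat1_def)

lemma L_0:
  assumes "j < n"
  shows "L_mat n a $$ (0, j) = (if a 1 \<noteq> 0 then if j = Suc m then [:- 2 / (N * a 1):] else 0
    else if j = m then [:2 / N:] else if j = Suc m then [:- 2 * (c + N) / N^2:] else 0)"
  using assms by (simp add: L_mat_def mat1_def Let_def N_def c_def power_mult_distrib mult_ac)

lemma L_1:
  assumes "j < n"
  shows "L_mat n a $$ (1, j) = (if a 1 \<noteq> 0 then if j = m then [:a 1 / (2 * N):]
      else if j = Suc m then Polynomial.smult (- 1 / (2 * N^2)) ([:c * a 1:] + Polynomial.smult N u_poly) else 0
    else if j = m then Polynomial.smult (- 1 / N) (shift (1/2) u_poly)
      else if j = Suc m then Polynomial.smult (1 / N^2) (Polynomial.smult c (shift (1/2) u_poly) + Polynomial.smult N u_poly)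
      else 0)"
  using assms by (simp add: L_mat_def mat1_def Let_def N_def c_def power_mult_distrib mult_ac)

text \<open>The last two columns are written so that summing over k yields combinations of
  \<open>S1\<close> and \<open>S2\<close>.\<close>

lemma L_SS:
  assumes "k < m" "j < n"
  shows "L_mat n a $$ (Suc (Suc k), j) = (if j = k then [:\<epsilon> / 2:]
    else if j = m then [:- \<epsilon> * (of_nat (Suc (Suc k)) * a (Suc (Suc k))) / (2 * N):]
    else if j = Suc m then [:\<epsilon> * (c * (of_nat (Suc (Suc k)) * a (Suc (Suc k))) - N * (of_nat (Suc k) * a (Suc k))) / (2 * N^2):]
    else 0)"
  using assms by (simp add: L_mat_def mat1_def Let_def N_def c_def \<epsilon>_def power_mult_distrib mult_ac del: of_nat_Suc)

lemma L_GL: "L_mat n a \<in> GL_poly n"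
proof -
  let ?L = "L_mat n a"
  have "\<exists>d. ?L $$ (0, m) * ?L $$ (1, Suc m) - ?L $$ (0, Suc m) * ?L $$ (1, m) = [:d:] \<and> d \<noteq> 0"
  proof (cases "a 1 = 0")
    case True
    \<comment> \<open>The terms with \<open>c\<close> cancel, and u(h) - u(h + 1/2) = -1 leaves a
      constant; the same difference gives the determinant for R.\<close>
    have "?L $$ (0, m) * ?L $$ (1, Suc m) - ?L $$ (0, Suc m) * ?L $$ (1, m) = [:- 2 / N^2:]"
      using True N_nz by (intro poly_extI) (simp add: L_0 L_1[unfolded One_nat_def] u_poly_def field_simps power2_eq_square)
    then show ?thesis using N_nz by auto
  next
    case False
    then have "?L $$ (0, m) * ?L $$ (1, Suc m) - ?L $$ (0, Suc m) * ?L $$ (1, m) = [:1 / N^2:]"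
      using N_nz by (simp add: L_0 L_1[unfolded One_nat_def] power2_eq_square)
    then show ?thesis using N_nz by auto
  qed
  then obtain d where d: "?L $$ (0, m) * ?L $$ (1, Suc m) - ?L $$ (0, Suc m) * ?L $$ (1, m) = [:d:]" "d \<noteq> 0"
    by blast
  show ?thesis
    using L_carrier d L_0 L_1 L_SS
    by (intro GL_poly_antiblockI[where c = "\<epsilon> / 2" and d = d]) (auto simp: \<epsilon>_def)
qed

lemma R_entries:
  "R_mat n a $$ (0, 0) = 1"
  "R_mat n a $$ (0, 1) = (if a 1 \<noteq> 0 then Polynomial.smult (- 1 / a 1) (shift (1/2) u_poly) else Polynomial.smult (1/2) (shift (1/2) u_poly))"
  "R_mat n a $$ (1, 0) = (if a 1 \<noteq> 0 then 0 else 1)"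
  "R_mat n a $$ (1, 1) = (if a 1 \<noteq> 0 then 1 else Polynomial.smult (1/2) u_poly)"
  "j < m \<Longrightarrow> R_mat n a $$ (0, Suc (Suc j)) = 0"
  "j < m \<Longrightarrow> R_mat n a $$ (1, Suc (Suc j)) = 0"
  "k < m \<Longrightarrow> j < n \<Longrightarrow> R_mat n a $$ (Suc (Suc k), j) = (if j = Suc (Suc k) then [:- \<epsilon>:] else 0)"
  by (auto simp: R_mat_def mat1_def \<epsilon>_def one_pCons)

lemma R_GL: "R_mat n a \<in> GL_poly n"
proof -
  let ?R = "R_mat n a"
  have "\<exists>d. ?R $$ (0, 0) * ?R $$ (1, 1) - ?R $$ (0, 1) * ?R $$ (1, 0) = [:d:] \<and> d \<noteq> 0"
  proof (cases "a 1 = 0")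
    case True
    then have "?R $$ (0, 0) * ?R $$ (1, 1) - ?R $$ (0, 1) * ?R $$ (1, 0) = [:- 1/2:]"
      unfolding R_entries by (intro poly_extI) (simp add: u_poly_def field_simps)
    then show ?thesis by auto
  next
    case False
    then have "?R $$ (0, 0) * ?R $$ (1, 1) - ?R $$ (0, 1) * ?R $$ (1, 0) = [:1:]"
      unfolding R_entries by (simp add: one_pCons)
    then show ?thesis by auto
  qed
  then obtain d where d: "?R $$ (0, 0) * ?R $$ (1, 1) - ?R $$ (0, 1) * ?R $$ (1, 0) = [:d:]" "d \<noteq> 0"
    by blast
  show ?thesis
    using R_carrier d R_entries(5-)
    by (intro GL_poly_blockI[where c = "- \<epsilon>" and d = d]) (auto simp: \<epsilon>_def)
qed

section \<open>Base change by L and the matrix of e\<close>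

lemma lc_v: "lc g n v w = h_act g (w 0) (v 0) + h_act g (w 1) (v 1) + (\<Sum>k<m. h_act g (w (Suc (Suc k))) (monom 1 k))"
  by (simp add: lc_SS v_def)

text \<open>For \<open>j < m\<close> the only entry is \<open>\<epsilon> / 2\<close>, at t^j. In the
  last two columns the lower rows give q and g' without their top terms, and the first two rows
  cancel what is not a multiple of t^j.\<close>

lemma L_col:
  assumes "j < n"
  shows "lc g n v (\<lambda>i. L_mat n a $$ (i, j)) = Polynomial.smult (\<epsilon> / 2) (monom 1 j)"
proof -
  have tail: "(\<Sum>k<m. h_act g (L_mat n a $$ (Suc (Suc k), j)) (monom 1 k))
    = (if j = m then Polynomial.smult (- \<epsilon> / (2 * N)) S2
       else if j = Suc m then Polynomial.smult (\<epsilon> * c / (2 * N^2)) S2 - Polynomial.smult (\<epsilon> / (2 * N)) S1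
       else Polynomial.smult (\<epsilon> / 2) (monom 1 j))" 
  proof -
    consider "j < m" | "j = m" | "j = Suc m"
      using assms by linarith
    then show ?thesis
    proof cases
      case 1
      have "(\<Sum>k<m. h_act g (L_mat n a $$ (Suc (Suc k), j)) (monom 1 k))
        = (\<Sum>k<m. if k = j then Polynomial.smult (\<epsilon> / 2) (monom 1 j) else 0)"
        using 1 assms by (intro sum.cong) (auto simp: L_SS)
      then show ?thesis
        using 1 by simp
    next
      case 2
      then show ?thesis
        using assms by (simp add: S2_def smult_sum_right L_SS smult_monom del: of_nat_Suc)
    next
      case 3
      then show ?thesis
        using assms N_nz
        by (simp add: S1_def S2_def smult_sum_right L_SS smult_monom diff_monom field_simps power2_eq_square
            flip: sum_subtractf del: of_nat_Suc)
    qed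
  qed
  have S1: "S1 = g' - monom c m - monom N (Suc m)" and S2: "S2 = q - monom N m"
    by (simp_all add: g'_eq q_def)
  consider "j < m" | "j = m" | "j = Suc m"
    using assms by linarith
  then show ?thesis
  proof cases
    case 1
    then show ?thesis
      using assms unfolding lc_v tail by (simp add: L_0 L_1[unfolded One_nat_def])
  next
    case 2
    show ?thesis
    proof (rule poly_extI)
      fix x
      \<comment> \<open>If \<open>a 1\<close> is zero, this column contains D g' through
        \<open>v 0\<close> and t D q through u(h + 1/2) acting on \<open>v 1\<close>.\<close>
      have X: "poly (D g') x = poly q x + x * poly (D q) x" if "a (Suc 0) = 0"
        using arg_cong[OF X_D_q, of "\<lambda>p. poly p x"] that by simp
      show "poly (lc g n v (\<lambda>i. L_mat n a $$ (i, j))) x = poly (Polynomial.smult (\<epsilon> / 2) (monom 1 j)) x"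
        using N_nz unfolding lc_v tail S2
        by (simp add: 2 X L_0 L_1[unfolded One_nat_def] v_def h_act_u \<epsilon>_def poly_monom field_simps)
    qed
  next
    case 3
    show ?thesis
    proof (rule poly_extI)
      fix x
      have X: "x * poly (D q) x = poly (D g') x - a (Suc 0) * poly g' x - poly q x"
        using arg_cong[OF X_D_q, of "\<lambda>p. poly p x"] by simp
      show "poly (lc g n v (\<lambda>i. L_mat n a $$ (i, j))) x = poly (Polynomial.smult (\<epsilon> / 2) (monom 1 j)) x"
      proof (cases "a (Suc 0) = 0")
        case True
        then have "poly (D g') x = poly q x + x * poly (D q) x"
          using X by simp
        then show ?thesis
          using N_nz True unfolding lc_v tail S1 S2
          by (simp add: 3 L_0 L_1[unfolded One_nat_def] v_def h_act_u \<epsilon>_def poly_monom field_simps power2_eq_square)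
      next
        case False
        show ?thesis
          using N_nz False unfolding lc_v tail S1 S2
          by (simp add: 3 X L_0 L_1[unfolded One_nat_def] v_def h_act_u \<epsilon>_def poly_monom field_simps power2_eq_square)
      qed
    qed
  qed
qed

text \<open>Up to the factor \<open>\<epsilon> / 2\<close>, the matrix of e from the basis v to the
  monomials.\<close>

definition E0 :: "complex poly mat" where
  "E0 = map_mat sigma (R_mat n a) * mat_diag n (\<lambda>i. if i = 0 then sigma (lam (1/4)) else -1)"

text \<open>In column 0, sigma(lambda) acts as e f, so \<open>v 0\<close> is
  \<open>\<epsilon> / 2\<close> times f applied to the generator 1 or 1 + t. In column 1 the entries
  of sigma(R) produce -t^2 q / a_1, or t^2 (g' + q) / 2 if a_1 = 0. The other columns are multiples
  of t^j with j at least 2.\<close>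

lemma E0_col:
  assumes "j < n"
  shows "Polynomial.smult (\<epsilon> / 2) (lc g n (monom 1) (\<lambda>k. E0 $$ (k, j))) = e_op (v j)"
proof -
  let ?R = "map_mat sigma (R_mat n a)"
  let ?d = "if j = 0 then sigma (lam (1/4)) else -1"
  have R: "?R \<in> carrier_mat n n"
    using R_carrier by simp
  have "lc g n (monom 1) (\<lambda>k. E0 $$ (k, j)) = lc g n (monom 1) (\<lambda>k. ?d * ?R $$ (k, j))"
    using assms R unfolding E0_def mat_diag_mult_right[OF R] by (intro lc_cong) (auto simp: mult.commute)
  also have "\<dots> = h_act g ?d (lc g n (monom 1) (\<lambda>k. ?R $$ (k, j)))"
    by (rule lc_mult)
  also have "lc g n (monom 1) (\<lambda>k. ?R $$ (k, j)) = h_act g (sigma (R_mat n a $$ (0, j))) 1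
      + h_act g (sigma (R_mat n a $$ (1, j))) [:0, 1:] + (\<Sum>k<m. h_act g (sigma (R_mat n a $$ (Suc (Suc k), j))) (monom 1 (Suc (Suc k))))"
    using assms R_carrier by (simp add: lc_SS monom_0 monom_Suc one_pCons)
  also have "(\<Sum>k<m. h_act g (sigma (R_mat n a $$ (Suc (Suc k), j))) (monom 1 (Suc (Suc k))))
      = (\<Sum>k<m. if Suc (Suc k) = j then Polynomial.smult (- \<epsilon>) (monom 1 j) else 0)"
    using assms by (intro sum.cong) (auto simp: R_entries sigma_def)
  finally have *: "lc g n (monom 1) (\<lambda>k. E0 $$ (k, j)) = h_act g ?d (h_act g (sigma (R_mat n a $$ (0, j))) 1
      + h_act g (sigma (R_mat n a $$ (1, j))) [:0, 1:]
      + (\<Sum>k<m. if Suc (Suc k) = j then Polynomial.smult (- \<epsilon>) (monom 1 j) else 0))" .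
  have D_const: "D [:1:] = g'"
    using D_1 by (simp add: one_pCons)
  have X: "D [:0, 1:] = 1 + pCons 0 g'"
    using exp_deriv_X_mult[of g 1] D_1 by (simp add: one_pCons)
  consider "j = 0" | "j = 1" | k where "j = Suc (Suc k)" "k < m"
    using assms by (metis One_nat_def Suc_less_eq not0_implies_Suc)
  then show ?thesis
  proof cases
    case 1
    \<comment> \<open>\<open>pCons 1 g'\<close> is D t, so this is the second derivative needed for
      f(1 + t).\<close>
    have "D (pCons 1 g') = g' + (g' + pCons 0 (D g'))"
      using exp_deriv_linear(1)[of g 1 "pCons 0 g'"] D_1 by (simp add: one_pCons)
    then show ?thesis
      unfolding * using 1 D_const
      by (intro poly_extI) (simp add: R_entries[unfolded One_nat_def] sigma_simps h_act_sigma_lam f_op_def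
          D_1 X v_def \<epsilon>_def e_op_def power2_eq_square field_simps)
  next
    case 2
    show ?thesis
    proof (rule poly_extI)
      fix x
      \<comment> \<open>Splitting off the constant term of g' exhibits the factor t^2 that e
        supplies.\<close>
      have "poly g' x = a (Suc 0) + x * poly q x"
        using arg_cong[OF g'_q, of "\<lambda>p. poly p x"] by simp
      then show "poly (Polynomial.smult (\<epsilon> / 2) (lc g n (monom 1) (\<lambda>k. E0 $$ (k, j)))) x = poly (e_op (v j)) x"
        unfolding * using 2 D_const
        by (simp add: R_entries[unfolded One_nat_def] sigma_simps h_act_u D_1 X v_def \<epsilon>_def e_op_def power2_eq_square field_simps)
    qed
  next
    case 3
    have "(\<Sum>k'<m. if Suc (Suc k') = j then Polynomial.smult (- \<epsilon>) (monom 1 j) else 0) = Polynomial.smult (- \<epsilon>) (monom 1 j)"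
      using 3 by simp
    then show ?thesis
      unfolding * using 3
      by (simp add: R_entries[unfolded One_nat_def] sigma_def v_def e_op_def \<epsilon>_def power2_eq_square monom_Suc)
  qed
qed

text \<open>The inverse of K is L(h+1) R(h). The sigma in \<open>M_param\<close> undoes the shift,
  so that E = L sigma(R) sigma(Pbar) with L itself as base change.\<close>

theorem T3_isomorphic_M_param:
  "T3 g \<simeq> M_param (1/4) (1, 0, n - 1)
    (GL_inv n (R_mat n a) * GL_inv n (map_mat (shift 1) (L_mat n a)))"
proof -
  let ?L = "L_mat n a" and ?R = "R_mat n a"
  let ?L1 = "map_mat (shift 1) ?L"
  have GL: "?L \<in> GL_poly n" "?R \<in> GL_poly n"
    by (rule L_GL R_GL)+
  have L1: "?L1 \<in> GL_poly n"
    using GL(1) by (rule GL_poly_map_shift)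
  define K where "K = GL_inv n ?R * GL_inv n ?L1"
  have K: "K \<in> GL_poly n" "GL_inv n K = ?L1 * ?R"
    unfolding K_def
    using GL_poly_mult[OF GL_polyD(3)[OF GL(2)] GL_polyD(3)[OF L1]] GL_polyD(6)[OF GL(2)] GL_polyD(6)[OF L1]
    by simp_all
  define P where "P = P_mat (1, 0, n - 1) (1/4)"
  define Pbar where "Pbar = Pbar_mat (1, 0, n - 1) (1/4)"
  have size: "size3 (1, 0, n - 1) = n"
    by simp
  have Pbar: "Pbar = mat_diag n (\<lambda>i. if i = 0 then lam (1/4) else -1)"
    unfolding Pbar_def Pbar_mat_eq size ..
  have P: "P \<in> carrier_mat n n" "Pbar \<in> carrier_mat n n" "Pbar * P = lam (1/4) \<cdot>\<^sub>m 1\<^sub>m n"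
    using theI'[OF Pbar_mat_ex1, of "(1, 0, n - 1)" "1/4", folded Pbar_mat_def]
    unfolding P_def Pbar_def size by (simp_all only: P_mat_def size mat_diag_dim)
  define E where "E = map_mat sigma (GL_inv n K * Pbar)"
  define F where "F = P * K"
  note K' = GL_polyD[OF K(1)] and L' = GL_polyD[OF GL(1)] and R' = GL_polyD[OF GL(2)] and L1' = GL_polyD[OF L1]
  have carrier: "E \<in> carrier_mat n n" "F \<in> carrier_mat n n" "E0 \<in> carrier_mat n n"
    using K' P R' by (auto simp: E_def F_def E0_def)
  have E: "E = ?L * E0"
  proof -
    have "E = map_mat sigma (?L1 * (?R * Pbar))"
      unfolding E_def K(2) using L1' R' P by (simp add: assoc_mult_mat[of _ n n _ n _ n])
    also have "\<dots> = map_mat sigma ?L1 * (map_mat sigma ?R * map_mat sigma Pbar)"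
      unfolding sigma_def using L1' R' P
      by (simp add: map_mat_shift_mult[of _ n n _ n])
    also have "map_mat sigma ?L1 = ?L"
      by (intro eq_matI) (auto simp: sigma_inverses simp flip: sigma_inv_def)
    also have "map_mat sigma Pbar = mat_diag n (\<lambda>i. if i = 0 then sigma (lam (1/4)) else -1)"
      unfolding Pbar by (intro eq_matI) (auto simp: mat_diag_def sigma_def)
    finally show ?thesis
      by (simp add: E0_def)
  qed
  \<comment> \<open>The factor Pbar P between the inverse of K and K is the scalar matrix lambda I,
    so conjugation by K leaves it unchanged.\<close>
  have "E * map_mat sigma F = map_mat sigma (GL_inv n K * Pbar * (P * K))"
    unfolding E_def F_def sigma_def using K' P
    by (simp add: map_mat_shift_mult[of _ n n _ n])
  also have "GL_inv n K * Pbar * (P * K) = GL_inv n K * (Pbar * P) * K"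
    using K'(1,2) P(1,2) by (simp add: assoc_mult_mat[of _ n n _ n _ n])
  also have "GL_inv n K * (Pbar * P) * K = lam (1/4) \<cdot>\<^sub>m 1\<^sub>m n"
    unfolding P(3) using K' by (simp add: mult_smult_distrib[of _ n n _ n] mult_smult_assoc_mat[of _ n n _ n])
  also have "map_mat sigma (lam (1/4) \<cdot>\<^sub>m 1\<^sub>m n) = sigma (lam (1/4)) \<cdot>\<^sub>m 1\<^sub>m n"
    by (intro eq_matI) (auto simp: sigma_def)
  finally have EF: "E * map_mat sigma F = sigma (lam (1/4)) \<cdot>\<^sub>m 1\<^sub>m n" .
  have L_col': "lc g n v (\<lambda>i. ?L $$ (i, j)) = Polynomial.smult (\<epsilon> / 2) (monom 1 j)" if "j < n" for j
    using L_col that by simp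
  have bij: "bij_betw (\<lambda>w. lc g n v (vec_index w)) (carrier_vec n) UNIV"
    using degree_g GL(1) L_col' by (intro bij_betw_lc[where s = "\<epsilon> / 2"]) (auto simp: \<epsilon>_def)
  have "T3 g \<simeq> M_mod n E F"
  proof (rule T3_isomorphic_M_modI[OF carrier(1,2) EF bij])
    fix j assume j: "j < n"
    have "lc g n v (\<lambda>i. E $$ (i, j)) = lc g n (\<lambda>k. lc g n v (\<lambda>i. ?L $$ (i, k))) (\<lambda>k. E0 $$ (k, j))"
      unfolding E using L' carrier j by (intro lc_mult_mat) auto
    also have "\<dots> = lc g n (\<lambda>k. Polynomial.smult (\<epsilon> / 2) (monom 1 k)) (\<lambda>k. E0 $$ (k, j))"
      by (intro lc_cong) (auto simp: L_col')
    also have "\<dots> = e_op (v j)"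
      using E0_col j by (simp add: lc_smult_left)
    finally show "lc g n v (\<lambda>i. E $$ (i, j)) = e_op (v j)" .
  qed
  then show ?thesis
    unfolding M_param_def Let_def size K_def[symmetric] P_def[symmetric] Pbar_def[symmetric]
      E_def[symmetric] F_def[symmetric] .
qed

end

theorem proposition6p9:
  fixes n :: nat and a :: "nat \<Rightarrow> complex" and g :: "complex poly"
  assumes "n \<ge> 2" and "a n \<noteq> 0"
    and "g = (\<Sum>i = 1..n. monom (a i) i)"
  shows "L_mat n a \<in> GL_poly n \<and> R_mat n a \<in> GL_poly n \<and>
    T3 g \<simeq> M_param (1/4) (1, 0, n - 1)
      (GL_inv n (R_mat n a) * GL_inv n (map_mat (shift 1) (L_mat n a)))"
proof -
  obtain m where n: "n = Suc (Suc m)"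
    using assms(1) by (metis add_2_eq_Suc le_Suc_ex)
  have "exp_module m a g"
    using assms by unfold_locales (simp_all add: n)
  then show ?thesis
    unfolding n using exp_module.L_GL exp_module.R_GL exp_module.T3_isomorphic_M_param by blast
qed

end
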